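(* Let $N\ge 1$. If the operator $J:T^*(M)\to T(M)$ is Hamiltonian, then the operator $\hat{J}_N:T^*(\hat{M}_N)\to T(\hat{M}_N)$ defined by the block matrix $$\hat{J}_N(\hat{\eta}_N)=\left[\frac{1}{(i+j-N)!}\left.\frac{\partial^{i+j-N}J(\hat u_N)}{\partial\varepsilon^{i+j-N}}\right|_{\varepsilon=0}\right]_{i,j=0,1,\dots,N},$$ where blocks with $i+j<N$ are zero (so the blocks with $i+j=N$ are $J(\eta_0)$) and $\hat u_N=\sum_{i=0}^N\varepsilon^i\eta_i$, is Hamiltonian too.
   Context: Setting. $M=M(u)$ is a manifold with variable $u$, a column vector with $q$ components (typically functions); it is treated as a linear space, so that $u+\varepsilon S$ makes sense, tangent vectors at all points lie in one fixed space $E$ and cotangent vectors in one fixed space $E^*$, with a nondegenerate duality pairing $\langle\cdot,\cdot\rangle$ between cotangent and tangent vectors. $\hat M_N=\hat M_N(\hat\eta_N)$ is the analogous manifold with variable $\hat\eta_N=(\eta_0^T,\dots,\eta_N^T)^T$, each $\eta_i$ being of the same kind and dimension as $u$; its tangent (cotangent) vectors are $(N+1)$-tuples of elements of $E$ (of $E^*$), the pairing is the sum of the componentwise pairings, and operators are $(N+1)\times(N+1)$ block matrices. $T(\cdot)$, $T^*(\cdot)$ denote tangent and cotangent bundles (membership means being a field). A linear operator $J:T^*(M)\to T(M)$ assigns to each $u$ a linear map $J(u)$ from cotangent to tangent vectors. All objects are assumed smooth, with as many derivatives as needed. Gateaux derivative: $X'(u)[S(u)]=\left.\frac{\partial}{\partial\varepsilon}X(u+\varepsilon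 S(u))\right|_{\varepsilon=0}$. A linear operator $J:T^*(M)\to T(M)$ is Hamiltonian if it is skew-symmetric, $\langle\alpha(u),J(u)\beta(u)\rangle=-\langle\beta(u),J(u)\alpha(u)\rangle$ for all $\alpha,\beta\in T^*(M)$, and for all $\alpha,\beta,\gamma\in T^*(M)$ $$\langle\alpha(u),J'(u)[J(u)\beta(u)]\gamma(u)\rangle+\mathrm{cycle}(\alpha,\beta,\gamma)=0,$$ where $\mathrm{cycle}$ denotes the two terms obtained by cyclic permutation. The same definition applies on $\hat M_N$. *)

theory Defs
  imports "HOL-Analysis.Analysis"
begin

section \<open>Locally convex spaces\<close>

text \<open>The manifold \<open>M\<close> is a linear space, typically a space of functions (e.g. smooth functions
  with their Frechet topology, on which differential operators act continuously), so points and
  tangent vectors live in one Hausdorff locally convex space and cotangent vectors in another.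
  Neither a norm nor completeness is assumed.\<close>

class lctvs = real_vector + topological_ab_group_add + t2_space +
  assumes tendsto_scaleR_nhds:
      "LIM p (nhds (a::real) \<times>\<^sub>F nhds x). fst p *\<^sub>R snd p :> nhds (a *\<^sub>R x)"
    and locally_convex:
      "open U \<Longrightarrow> 0 \<in> U \<Longrightarrow> \<exists>V. open V \<and> 0 \<in> V \<and> V \<subseteq> U \<and>
         (\<forall>x\<in>V. \<forall>y\<in>V. \<forall>t::real. 0 \<le> t \<and> t \<le> 1 \<longrightarrow> (1 - t) *\<^sub>R x + t *\<^sub>R y \<in> V)"

instance real_normed_vector \<subseteq> lctvs
proof
  fix a :: real and x :: 'a
  show "LIM p (nhds a \<times>\<^sub>F nhds x). fst p *\<^sub>R snd p :> nhds (a *\<^sub>R x)"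
    by (intro tendsto_scaleR filterlim_fst filterlim_snd)
next
  fix U :: "'a set"
  assume "open U" "0 \<in> U"
  then obtain e where e: "e > 0" "ball 0 e \<subseteq> U"
    by (auto simp: open_contains_ball)
  have "convex (ball (0::'a) e)" by (rule convex_ball)
  then have "\<forall>x\<in>ball (0::'a) e. \<forall>y\<in>ball 0 e. \<forall>t::real. 0 \<le> t \<and> t \<le> 1 \<longrightarrow>
      (1 - t) *\<^sub>R x + t *\<^sub>R y \<in> ball 0 e"
    unfolding convex_alt by blast
  with e show "\<exists>V. open V \<and> 0 \<in> V \<and> V \<subseteq> U \<and>
      (\<forall>x\<in>V. \<forall>y\<in>V. \<forall>t::real. 0 \<le> t \<and> t \<le> 1 \<longrightarrow> (1 - t) *\<^sub>R x + t *\<^sub>R y \<in> V)"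
    by (intro exI[of _ "ball 0 e"]) auto
qed

lemma tendsto_scaleR_lctvs:
  fixes g :: "'c \<Rightarrow> 'a::lctvs"
  assumes "(f \<longlongrightarrow> a) F" "(g \<longlongrightarrow> x) F"
  shows "((\<lambda>t. f t *\<^sub>R g t) \<longlongrightarrow> a *\<^sub>R x) F"
  using filterlim_compose[OF tendsto_scaleR_nhds filterlim_Pair[OF assms]] by simp

instance prod :: (topological_monoid_add, topological_monoid_add) topological_monoid_add
proof
  fix a b :: "'a \<times> 'b"
  have f: "filterlim (\<lambda>x. x) (nhds a \<times>\<^sub>F nhds b) (nhds a \<times>\<^sub>F nhds b)"
    by (rule filterlim_ident)
  have "((\<lambda>x. (fst (fst x) + fst (snd x), snd (fst x) + snd (snd x)))
      \<longlongrightarrow> (fst a + fst b, snd a + snd b)) (nhds a \<times>\<^sub>F nhds b)"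
    by (intro tendsto_Pair tendsto_add tendsto_fst tendsto_snd filterlim_fst filterlim_snd)
  then show "((\<lambda>x. fst x + snd x) \<longlongrightarrow> a + b) (nhds a \<times>\<^sub>F nhds b)"
    by (simp add: plus_prod_def)
qed

instance prod :: (topological_comm_monoid_add, topological_comm_monoid_add) topological_comm_monoid_add ..

instance prod :: (topological_group_add, topological_group_add) topological_group_add
proof
  fix a :: "'a \<times> 'b"
  have "((\<lambda>x. (- fst x, - snd x)) \<longlongrightarrow> (- fst a, - snd a)) (nhds a)"
    by (intro tendsto_Pair tendsto_minus tendsto_fst tendsto_snd filterlim_ident)
  then show "(uminus \<longlongrightarrow> - a) (nhds a)"
    by (simp add: uminus_prod_def[abs_def])
qed

instance prod :: (topological_ab_group_add, topological_ab_group_add) topological_ab_group_add ..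

instance prod :: (lctvs, lctvs) lctvs
proof
  fix a :: real and x :: "'a \<times> 'b"
  show "LIM p (nhds a \<times>\<^sub>F nhds x). fst p *\<^sub>R snd p :> nhds (a *\<^sub>R x)"
    unfolding scaleR_prod_def
    by (intro tendsto_Pair tendsto_scaleR_lctvs tendsto_fst tendsto_snd filterlim_fst filterlim_snd)
next
  fix U :: "('a \<times> 'b) set"
  assume "open U" "0 \<in> U"
  then obtain A B where AB: "open A" "open B" "0 \<in> A" "0 \<in> B" "A \<times> B \<subseteq> U"
    by (auto simp: zero_prod_def elim!: open_prod_elim)
  obtain V where V: "open V" "0 \<in> V" "V \<subseteq> A"
      "\<forall>x\<in>V. \<forall>y\<in>V. \<forall>t::real. 0 \<le> t \<and> t \<le> 1 \<longrightarrow> (1 - t) *\<^sub>R x + t *\<^sub>R y \<in> V"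
    using locally_convex[OF AB(1,3)] by blast
  obtain W where W: "open W" "0 \<in> W" "W \<subseteq> B"
      "\<forall>x\<in>W. \<forall>y\<in>W. \<forall>t::real. 0 \<le> t \<and> t \<le> 1 \<longrightarrow> (1 - t) *\<^sub>R x + t *\<^sub>R y \<in> W"
    using locally_convex[OF AB(2,4)] by blast
  have "open (V \<times> W)" "0 \<in> V \<times> W" "V \<times> W \<subseteq> U"
    using V(1-3) W(1-3) AB(5) by (auto simp: zero_prod_def intro: open_Times)
  moreover have "(1 - t) *\<^sub>R x + t *\<^sub>R y \<in> V \<times> W"
    if "x \<in> V \<times> W" "y \<in> V \<times> W" "0 \<le> t" "t \<le> 1" for x y and t :: real
    using that V(4) W(4) by (auto simp: mem_Times_iff)
  ultimately show "\<exists>V. open V \<and> 0 \<in> V \<and> V \<subseteq> U \<and>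
      (\<forall>x\<in>V. \<forall>y\<in>V. \<forall>t::real. 0 \<le> t \<and> t \<le> 1 \<longrightarrow> (1 - t) *\<^sub>R x + t *\<^sub>R y \<in> V)"
    by (intro exI[of _ "V \<times> W"] conjI ballI allI impI) auto
qed

instance vec :: (topological_monoid_add, finite) topological_monoid_add
proof
  fix a b :: "'a ^ 'b"
  have "((\<lambda>x. \<chi> i. fst x $ i + snd x $ i) \<longlongrightarrow> (\<chi> i. a $ i + b $ i)) (nhds a \<times>\<^sub>F nhds b)"
    by (intro tendsto_vec_lambda tendsto_add tendsto_vec_nth filterlim_fst filterlim_snd)
  then show "((\<lambda>x. fst x + snd x) \<longlongrightarrow> a + b) (nhds a \<times>\<^sub>F nhds b)"
    by (simp add: plus_vec_def)
qed

instance vec :: (topological_comm_monoid_add, finite) topological_comm_monoid_add ..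

instance vec :: (topological_group_add, finite) topological_group_add
proof
  fix a :: "'a ^ 'b"
  have "((\<lambda>x. \<chi> i. - (x $ i)) \<longlongrightarrow> (\<chi> i. - (a $ i))) (nhds a)"
    by (intro tendsto_vec_lambda tendsto_minus tendsto_vec_nth filterlim_ident)
  then show "(uminus \<longlongrightarrow> - a) (nhds a)"
    by (simp add: uminus_vec_def[abs_def])
qed

instance vec :: (topological_ab_group_add, finite) topological_ab_group_add ..

instance vec :: (t0_space, finite) t0_space
proof
  fix x y :: "'a ^ 'b"
  assume "x \<noteq> y"
  then obtain i where i: "x $ i \<noteq> y $ i" by (auto simp: vec_eq_iff)
  from t0_space_class.t0_space[OF i] obtain U where U: "open U" "\<not> (x $ i \<in> U \<longleftrightarrow> y $ i \<in> U)"
    by blast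
  show "\<exists>U. open U \<and> \<not> (x \<in> U \<longleftrightarrow> y \<in> U)"
    using U open_vimage_vec_nth[OF U(1), of i]
    by (intro exI[of _ "(\<lambda>x. x $ i) -` U"]) simp
qed

instance vec :: (t1_space, finite) t1_space
proof
  fix x y :: "'a ^ 'b"
  assume "x \<noteq> y"
  then obtain i where i: "x $ i \<noteq> y $ i" by (auto simp: vec_eq_iff)
  from t1_space_class.t1_space[OF i] obtain U where U: "open U" "x $ i \<in> U" "y $ i \<notin> U"
    by blast
  show "\<exists>U. open U \<and> x \<in> U \<and> y \<notin> U"
    using U open_vimage_vec_nth[OF U(1), of i]
    by (intro exI[of _ "(\<lambda>x. x $ i) -` U"]) simp
qed

instance vec :: (t2_space, finite) t2_space
proof
  fix x y :: "'a ^ 'b"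
  assume "x \<noteq> y"
  then obtain i where i: "x $ i \<noteq> y $ i" by (auto simp: vec_eq_iff)
  from hausdorff[OF i] obtain U V where UV: "open U" "open V" "x $ i \<in> U" "y $ i \<in> V" "U \<inter> V = {}"
    by blast
  show "\<exists>U V. open U \<and> open V \<and> x \<in> U \<and> y \<in> V \<and> U \<inter> V = {}"
    using UV open_vimage_vec_nth[OF UV(1), of i] open_vimage_vec_nth[OF UV(2), of i]
    by (intro exI[of _ "(\<lambda>x. x $ i) -` U"] exI[of _ "(\<lambda>x. x $ i) -` V"]) auto
qed

instance vec :: (lctvs, finite) lctvs
proof
  fix a :: real and x :: "'a ^ 'b"
  show "LIM p (nhds a \<times>\<^sub>F nhds x). fst p *\<^sub>R snd p :> nhds (a *\<^sub>R x)"
    unfolding scaleR_vec_def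
    by (intro tendsto_vec_lambda tendsto_scaleR_lctvs tendsto_vec_nth filterlim_fst filterlim_snd)
next
  fix U :: "('a ^ 'b) set"
  assume "open U" "0 \<in> U"
  then obtain A where "\<forall>i. open (A i) \<and> (0 :: 'a ^ 'b) $ i \<in> A i"
      "\<forall>y. (\<forall>i. y $ i \<in> A i) \<longrightarrow> y \<in> U"
    unfolding open_vec_def by blast
  then have A: "\<And>i. open (A i)" "\<And>i. 0 \<in> A i" "\<And>y. (\<forall>i. y $ i \<in> A i) \<Longrightarrow> y \<in> U"
    by auto
  have "\<forall>i. \<exists>V. open V \<and> 0 \<in> V \<and> V \<subseteq> A i \<and>
      (\<forall>x\<in>V. \<forall>y\<in>V. \<forall>t::real. 0 \<le> t \<and> t \<le> 1 \<longrightarrow> (1 - t) *\<^sub>R x + t *\<^sub>R y \<in> V)"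
    using locally_convex[OF A(1,2)] by simp
  from choice[OF this] obtain V where V: "\<forall>i. open (V i) \<and> 0 \<in> V i \<and> V i \<subseteq> A i \<and>
      (\<forall>x\<in>V i. \<forall>y\<in>V i. \<forall>t::real. 0 \<le> t \<and> t \<le> 1 \<longrightarrow>
        (1 - t) *\<^sub>R x + t *\<^sub>R y \<in> V i)"
    by blast
  have "open {x. \<forall>i. x $ i \<in> V i}"
    using V by (intro open_vector_box) blast
  moreover have "{x. \<forall>i. x $ i \<in> V i} \<subseteq> U"
    using V A(3) by blast
  moreover have "0 \<in> {x. \<forall>i. x $ i \<in> V i}"
    using V by simp
  moreover have "(1 - t) *\<^sub>R x + t *\<^sub>R y \<in> {x. \<forall>i. x $ i \<in> V i}"
    if "x \<in> {x. \<forall>i. x $ i \<in> V i}" "y \<in> {x. \<forall>i. x $ i \<in> V i}" "0 \<le> t" "t \<le> 1"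
    for x y :: "'a ^ 'b" and t :: real
    using that V by simp
  ultimately show "\<exists>V. open V \<and> 0 \<in> V \<and> V \<subseteq> U \<and>
      (\<forall>x\<in>V. \<forall>y\<in>V. \<forall>t::real. 0 \<le> t \<and> t \<le> 1 \<longrightarrow> (1 - t) *\<^sub>R x + t *\<^sub>R y \<in> V)"
    by (intro exI[of _ "{x. \<forall>i. x $ i \<in> V i}"] conjI ballI allI impI) auto
qed


section \<open>Gateaux derivatives and smoothness\<close>

definition gateaux :: "('a::real_vector \<Rightarrow> 'b::lctvs) \<Rightarrow> 'a \<Rightarrow> 'a \<Rightarrow> 'b" where
  "gateaux X u S = Lim (at 0) (\<lambda>\<epsilon>::real. (X (u + \<epsilon> *\<^sub>R S) - X u) /\<^sub>R \<epsilon>)"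

definition gateaux_differentiable :: "('a::real_vector \<Rightarrow> 'b::lctvs) \<Rightarrow> 'a \<Rightarrow> 'a \<Rightarrow> bool" where
  "gateaux_differentiable X u S \<longleftrightarrow>
     (\<exists>D. ((\<lambda>\<epsilon>::real. (X (u + \<epsilon> *\<^sub>R S) - X u) /\<^sub>R \<epsilon>) \<longlongrightarrow> D) (at 0))"

fun iter_gateaux :: "('a::real_vector \<Rightarrow> 'b::lctvs) \<Rightarrow> 'a list \<Rightarrow> 'a \<Rightarrow> 'b" where
  "iter_gateaux X [] = X"
| "iter_gateaux X (S # Ss) = (\<lambda>u. gateaux (iter_gateaux X Ss) u S)"

text \<open>Smoothness on locally convex spaces in the usual (Michal--Bastiani) sense: for every \<open>k\<close> the
  \<open>k\<close>-fold directional derivative exists and is jointly continuous in the point and the \<open>k\<close>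
  directions. The directions are the first \<open>k\<close> terms of a sequence in the product topology; the
  other terms play no role.\<close>

definition smooth :: "('a::lctvs \<Rightarrow> 'b::lctvs) \<Rightarrow> bool" where
  "smooth X \<longleftrightarrow>
     (\<forall>Ss u S. gateaux_differentiable (iter_gateaux X Ss) u S) \<and>
     (\<forall>k. continuous_on UNIV
        (\<lambda>(u, \<sigma> :: nat \<Rightarrow> 'a). iter_gateaux X (map \<sigma> [0..<k]) u))"

text \<open>The \<open>k\<close>-th derivative of a curve, as the iterated derivative in the direction \<open>1\<close>.\<close>

definition curve_deriv :: "nat \<Rightarrow> (real \<Rightarrow> 'b::lctvs) \<Rightarrow> real \<Rightarrow> 'b" where
  "curve_deriv k c = iter_gateaux c (replicate k 1)"


section \<open>Hamiltonian operators\<close>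

text \<open>The first argument of a pairing is the cotangent vector. Joint continuity of the pairing is
  not required: it fails for evaluation on a non-normable space.\<close>

definition duality_pairing :: "('f::lctvs \<Rightarrow> 'e::lctvs \<Rightarrow> real) \<Rightarrow> bool" where
  "duality_pairing pair \<longleftrightarrow>
     (\<forall>\<alpha>. linear (pair \<alpha>)) \<and> (\<forall>S. linear (\<lambda>\<alpha>. pair \<alpha> S)) \<and>
     (\<forall>\<alpha>. continuous_on UNIV (pair \<alpha>)) \<and> (\<forall>S. continuous_on UNIV (\<lambda>\<alpha>. pair \<alpha> S)) \<and>
     (\<forall>\<alpha>. (\<forall>S. pair \<alpha> S = 0) \<longrightarrow> \<alpha> = 0) \<and> (\<forall>S. (\<forall>\<alpha>. pair \<alpha> S = 0) \<longrightarrow> S = 0)"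

definition cotangent_fields :: "('e::lctvs \<Rightarrow> 'f::lctvs) set" where
  "cotangent_fields = {\<alpha>. smooth \<alpha>}"

text \<open>\<open>J u\<close> maps cotangent vectors to tangent vectors at \<open>u\<close>. Joint smoothness ensures that
  \<open>\<lambda>u. J u (\<alpha> u)\<close> is a smooth vector field for each cotangent field \<open>\<alpha>\<close>.\<close>

definition linear_operator :: "('e::lctvs \<Rightarrow> 'f::lctvs \<Rightarrow> 'e) \<Rightarrow> bool" where
  "linear_operator J \<longleftrightarrow> (\<forall>u. linear (J u)) \<and> smooth (\<lambda>(u, \<gamma>). J u \<gamma>)"

text \<open>\<open>op_deriv J u S \<gamma>\<close> is \<open>J'(u)[S]\<gamma>\<close>: only the operator is differentiated, the covector
  \<open>\<gamma>\<close> is kept fixed.\<close>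

definition op_deriv :: "('e::lctvs \<Rightarrow> 'f::lctvs \<Rightarrow> 'e) \<Rightarrow> 'e \<Rightarrow> 'e \<Rightarrow> 'f \<Rightarrow> 'e" where
  "op_deriv J u S \<gamma> = gateaux (\<lambda>v. J v \<gamma>) u S"

definition hamiltonian ::
    "('f::lctvs \<Rightarrow> 'e::lctvs \<Rightarrow> real) \<Rightarrow> ('e \<Rightarrow> 'f \<Rightarrow> 'e) \<Rightarrow> bool" where
  "hamiltonian pair J \<longleftrightarrow>
     linear_operator J \<and>
     (\<forall>\<alpha> \<in> cotangent_fields. \<forall>\<beta> \<in> cotangent_fields. \<forall>u.
        pair (\<alpha> u) (J u (\<beta> u)) = - pair (\<beta> u) (J u (\<alpha> u))) \<and>
     (\<forall>\<alpha> \<in> cotangent_fields. \<forall>\<beta> \<in> cotangent_fields. \<forall>\<gamma> \<in> cotangent_fields. \<forall>u.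
        pair (\<alpha> u) (op_deriv J u (J u (\<beta> u)) (\<gamma> u)) +
        pair (\<beta> u) (op_deriv J u (J u (\<gamma> u)) (\<alpha> u)) +
        pair (\<gamma> u) (op_deriv J u (J u (\<alpha> u)) (\<beta> u)) = 0)"


section \<open>The perturbed operator\<close>

text \<open>An \<open>(N+1)\<close>-tuple is a vector over a finite type \<open>'n\<close> whose elements are numbered by
  a bijection \<open>idx\<close> onto \<open>{0..N}\<close>; such a type exists for every \<open>N\<close>. The component
  \<open>\<eta>\<^sub>k\<close> of \<open>\<eta>\<close> is \<open>\<eta> $ i\<close> with \<open>idx i = k\<close>.\<close>

definition hat_pair :: "('f \<Rightarrow> 'e \<Rightarrow> real) \<Rightarrow> 'f ^ 'n \<Rightarrow> 'e ^ 'n::finite \<Rightarrow> real" where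
  "hat_pair pair \<alpha> S = (\<Sum>i\<in>UNIV. pair (\<alpha> $ i) (S $ i))"

definition u_hat :: "('n::finite \<Rightarrow> nat) \<Rightarrow> 'e::real_vector ^ 'n \<Rightarrow> real \<Rightarrow> 'e" where
  "u_hat idx \<eta> \<epsilon> = (\<Sum>i\<in>UNIV. \<epsilon> ^ idx i *\<^sub>R \<eta> $ i)"

definition J_hat_block ::
    "nat \<Rightarrow> ('n::finite \<Rightarrow> nat) \<Rightarrow> ('e::lctvs \<Rightarrow> 'f \<Rightarrow> 'e) \<Rightarrow> 'e ^ 'n \<Rightarrow> nat \<Rightarrow> nat \<Rightarrow> 'f \<Rightarrow> 'e" where
  "J_hat_block N idx J \<eta> i j \<gamma> =
     (if i + j < N then 0
      else (1 / fact (i + j - N)) *\<^sub>R curve_deriv (i + j - N) (\<lambda>\<epsilon>. J (u_hat idx \<eta> \<epsilon>) \<gamma>) 0)"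

definition J_hat ::
    "nat \<Rightarrow> ('n::finite \<Rightarrow> nat) \<Rightarrow> ('e::lctvs \<Rightarrow> 'f \<Rightarrow> 'e) \<Rightarrow> 'e ^ 'n \<Rightarrow> 'f ^ 'n \<Rightarrow> 'e ^ 'n" where
  "J_hat N idx J \<eta> \<gamma> = (\<chi> i. \<Sum>j\<in>UNIV. J_hat_block N idx J \<eta> (idx i) (idx j) (\<gamma> $ j))"

end

theory Submission
  imports Defs
begin

text \<open>Identify a tuple \<open>\<eta>\<close> with the polynomial curve \<open>u_hat idx \<eta>\<close>, i.e. with its first \<open>N + 1\<close> Taylor
  coefficients. Reversing the numbering of covectors, \<open>\<alpha>_hat(\<epsilon>) = \<Sum>\<^sub>i \<epsilon>\<^sup>N\<^sup>-\<^sup>i \<alpha>\<^sub>i\<close>, the pairing of tuples is the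
  coefficient of \<open>\<epsilon>\<^sup>N\<close> in the pairing of curves, and \<open>J_hat \<beta>\<close> is the truncation of \<open>J(u_hat) \<beta>_hat\<close> modulo
  \<open>\<epsilon>\<^sup>N\<^sup>+\<^sup>1\<close>. Hence skew symmetry and the Jacobi identity for \<open>J_hat\<close> are the coefficients of \<open>\<epsilon>\<^sup>N\<close> in the
  corresponding identities for \<open>J\<close> along the curve \<open>u_hat\<close>. Symmetry of mixed derivatives moves the
  derivative in \<open>\<eta>\<close> inside the Taylor coefficient, and a Leibniz rule shows that only the first \<open>N + 1\<close>
  coefficients of the direction matter. The calculus this needs on locally convex spaces rests on
  a mean value theorem for open convex sets.\<close>

section \<open>Difference quotients\<close>

lemma gateauxI:
  assumes "((\<lambda>\<epsilon>::real. (X (u + \<epsilon> *\<^sub>R S) - X u) /\<^sub>R \<epsilon>) \<longlongrightarrow> D) (at 0)"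
  shows "gateaux X u S = D"
  unfolding gateaux_def using assms by (rule tendsto_Lim[rotated]) simp

lemma gateaux_tendsto:
  assumes "gateaux_differentiable X u S"
  shows "((\<lambda>\<epsilon>::real. (X (u + \<epsilon> *\<^sub>R S) - X u) /\<^sub>R \<epsilon>) \<longlongrightarrow> gateaux X u S) (at 0)"
  using assms gateauxI unfolding gateaux_differentiable_def by metis

text \<open>The quotient over \<open>[a, c]\<close> is the convex combination of the quotients over
  \<open>[a, b]\<close> and \<open>[b, c]\<close>, weighted by the relative lengths of these
  intervals.\<close>

lemma convex_quotient_combine:
  fixes p :: "real \<Rightarrow> 'a::real_vector"
  assumes "convex V" "a < b" "b < c"
    "(p b - p a) /\<^sub>R (b - a) \<in> V" "(p c - p b) /\<^sub>R (c - b) \<in> V"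
  shows "(p c - p a) /\<^sub>R (c - a) \<in> V"
proof -
  have "((b - a) / (c - a)) *\<^sub>R ((p b - p a) /\<^sub>R (b - a)) +
      ((c - b) / (c - a)) *\<^sub>R ((p c - p b) /\<^sub>R (c - b)) \<in> V"
    using assms by (intro convexD) (auto simp: add_divide_distrib[symmetric])
  moreover have "((b - a) / (c - a)) *\<^sub>R ((p b - p a) /\<^sub>R (b - a)) +
      ((c - b) / (c - a)) *\<^sub>R ((p c - p b) /\<^sub>R (c - b)) = (p c - p a) /\<^sub>R (c - a)"
  proof -
    have "((b - a) / (c - a)) *\<^sub>R (v /\<^sub>R (b - a)) = v /\<^sub>R (c - a)"
      "((c - b) / (c - a)) *\<^sub>R (v /\<^sub>R (c - b)) = v /\<^sub>R (c - a)" for v :: 'a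
      using assms(2,3) by (simp_all add: divide_inverse)
    then show ?thesis by (simp only:) (simp add: scaleR_diff_right)
  qed
  ultimately show ?thesis by simp
qed

text \<open>The property ``difference quotient in \<open>V\<close>'' is
  additive over adjacent intervals by convexity and holds on short intervals by openness, so no
  completeness and no Hahn--Banach theorem are needed.\<close>

lemma mean_value_convex:
  fixes p :: "real \<Rightarrow> 'a::lctvs"
  assumes der: "\<And>s. 0 \<le> s \<Longrightarrow> s \<le> 1 \<Longrightarrow> ((\<lambda>h. (p (s + h) - p s) /\<^sub>R h) \<longlongrightarrow> p' s) (at 0)"
    and V: "convex V" "open V"
    and in_V: "\<And>s. 0 \<le> s \<Longrightarrow> s \<le> 1 \<Longrightarrow> p' s \<in> V"
  shows "p 1 - p 0 \<in> V"
proof -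
  define P where "P = (\<lambda>a b. a < b \<longrightarrow> (p b - p a) /\<^sub>R (b - a) \<in> V)"
  have "(0::real) \<le> 1" by simp
  then have "P 0 1"
  proof (induction rule: Bolzano)
    case (trans a b c)
    then show ?case
      using convex_quotient_combine[OF V(1), of a b c p] unfolding P_def
      by (cases "a = b"; cases "b = c") auto
  next
    case (local x)
    have "\<forall>\<^sub>F h in at 0. (p (x + h) - p x) /\<^sub>R h \<in> V"
      using topological_tendstoD[OF der V(2) in_V] local by blast
    then obtain d where d: "d > 0" "\<And>h. h \<noteq> 0 \<Longrightarrow> \<bar>h\<bar> < d \<Longrightarrow> (p (x + h) - p x) /\<^sub>R h \<in> V"
      by (auto simp: eventually_at dist_real_def)
    \<comment> \<open>Differentiability at \<open>x\<close> controls only quotients with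
      \<open>x\<close> as an endpoint, so an interval around \<open>x\<close> is cut at
      \<open>x\<close> and the two quotients are recombined.\<close>
    have "P a b" if "a \<le> x" "x \<le> b" "b - a < d" for a b
    proof -
      have 1: "(p b - p x) /\<^sub>R (b - x) \<in> V" if "x < b"
        using d(2)[of "b - x"] that \<open>b - a < d\<close> \<open>a \<le> x\<close> by simp
      have 2: "(p x - p a) /\<^sub>R (x - a) \<in> V" if "a < x"
      proof -
        have "(p a - p x) /\<^sub>R (a - x) \<in> V"
          using d(2)[of "a - x"] that \<open>b - a < d\<close> \<open>x \<le> b\<close> by simp
        moreover have "(p a - p x) /\<^sub>R (a - x) = (p x - p a) /\<^sub>R (x - a)"
        proof -
          have "inverse (a - x) = - inverse (x - a)"
            by (metis inverse_minus_eq minus_diff_eq)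
          then show ?thesis by (simp add: scaleR_diff_right)
        qed
        ultimately show ?thesis by simp
      qed
      show ?thesis
        using that 1 2 convex_quotient_combine[OF V(1), of a x b p] unfolding P_def
        by (cases "a = x"; cases "x = b") auto
    qed
    then show ?case using d(1) by blast
  qed
  then show ?thesis by (simp add: P_def)
qed

text \<open>By the mean value theorem the quotient lies in every open convex set that contains the
  derivatives along the segment from \<open>x i\<close> to \<open>x i + t i *\<^sub>R y i\<close>.
  Maps, base points, directions and steps may all vary with \<open>i\<close>. The factor
  \<open>principal {0..1}\<close> makes the limit of the derivatives uniform over the
  segment.\<close>

lemma difference_quotient_tendsto:
  fixes X D :: "'i \<Rightarrow> 'a::lctvs \<Rightarrow> 'b::lctvs"
  assumes der: "\<And>i u. ((\<lambda>\<epsilon>::real. (X i (u + \<epsilon> *\<^sub>R y i) - X i u) /\<^sub>R \<epsilon>) \<longlongrightarrow> D i u) (at 0)"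
    and lim: "((\<lambda>(i, \<theta>). D i (x i + (\<theta> * t i) *\<^sub>R y i)) \<longlongrightarrow> d) (F \<times>\<^sub>F principal {0..1})"
    and t: "\<forall>\<^sub>F i in F. t i \<noteq> (0::real)"
  shows "((\<lambda>i. (X i (x i + t i *\<^sub>R y i) - X i (x i)) /\<^sub>R t i) \<longlongrightarrow> d) F"
proof (rule topological_tendstoI)
  fix U assume U: "open U" "d \<in> U"
  have "open ((\<lambda>z. d + z) -` U)"
    using U(1) by (intro open_vimage continuous_intros)
  from locally_convex[OF this] U(2) obtain W where W: "open W" "0 \<in> W" "W \<subseteq> (\<lambda>z. d + z) -` U"
    "\<And>x y t. x \<in> W \<Longrightarrow> y \<in> W \<Longrightarrow> 0 \<le> t \<Longrightarrow> t \<le> (1::real) \<Longrightarrow> (1 - t) *\<^sub>R x + t *\<^sub>R y \<in> W"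
    by auto
  \<comment> \<open>Local convexity is available only at the origin; the convex neighbourhood is
    translated to \<open>d\<close>.\<close>
  define V where "V = (\<lambda>z. z - d) -` W"
  have V: "open V" "d \<in> V" "V \<subseteq> U"
    using W(1-3) by (auto simp: V_def intro!: open_vimage continuous_on_diff)
  have "convex W" unfolding convex_alt using W(4) by blast
  moreover have "V = (+) d ` W"
    by (auto simp: V_def image_iff) (metis add.commute diff_add_cancel)
  ultimately have cV: "convex V" by (simp add: convex_translation)
  have "\<forall>\<^sub>F z in F \<times>\<^sub>F principal {0..1}. (case z of (i, \<theta>) \<Rightarrow> D i (x i + (\<theta> * t i) *\<^sub>R y i)) \<in> V"
    using topological_tendstoD[OF lim V(1,2)] .
  then have "\<forall>\<^sub>F i in F. \<forall>\<theta>\<in>{0..1}. D i (x i + (\<theta> * t i) *\<^sub>R y i) \<in> V"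
    unfolding eventually_prod_filter eventually_principal
    by (auto elim!: eventually_mono)
  then show "\<forall>\<^sub>F i in F. (X i (x i + t i *\<^sub>R y i) - X i (x i)) /\<^sub>R t i \<in> U"
    using t
  proof eventually_elim
    case (elim i)
    \<comment> \<open>Dividing by \<open>t i\<close> makes \<open>p 1 - p 0\<close> the difference
      quotient itself and cancels the inner factor \<open>t i\<close> in the derivative of
      \<open>p\<close>.\<close>
    define p where "p = (\<lambda>s. X i (x i + (s * t i) *\<^sub>R y i) /\<^sub>R t i)"
    have "p 1 - p 0 \<in> V"
    proof (rule mean_value_convex[where p' = "\<lambda>s. D i (x i + (s * t i) *\<^sub>R y i)"])
      fix s :: real
      have "filterlim (\<lambda>h. h * t i) (at 0) (at 0)"
        using elim(2) by (intro filterlim_atI tendsto_eq_intros)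
          (auto simp: eventually_at_filter)
      then have "((\<lambda>h. (X i (x i + (s * t i) *\<^sub>R y i + (h * t i) *\<^sub>R y i) -
          X i (x i + (s * t i) *\<^sub>R y i)) /\<^sub>R (h * t i)) \<longlongrightarrow> D i (x i + (s * t i) *\<^sub>R y i)) (at 0)"
        by (rule filterlim_compose[OF der])
      then show "((\<lambda>h. (p (s + h) - p s) /\<^sub>R h) \<longlongrightarrow> D i (x i + (s * t i) *\<^sub>R y i)) (at 0)"
        by (simp add: p_def algebra_simps scaleR_diff_right)
    qed (use elim cV V(1) in auto)
    then show ?case using V(3) by (auto simp: p_def scaleR_diff_right)
  qed
qed

section \<open>Iterated derivatives of smooth maps\<close>

lemma tendsto_fun_iff:
  fixes f :: "'i \<Rightarrow> 'a \<Rightarrow> 'b::topological_space"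
  shows "(f \<longlongrightarrow> l) F \<longleftrightarrow> (\<forall>k. ((\<lambda>i. f i k) \<longlongrightarrow> l k) F)"
  using limitin_componentwise[of "\<lambda>_. euclidean" UNIV f l F]
  by (simp add: euclidean_product_topology)

lemma continuous_on_UNIV_tendsto:
  assumes "continuous_on UNIV f" "(x \<longlongrightarrow> l) F"
  shows "((\<lambda>i. f (x i)) \<longlongrightarrow> f l) F"
  using assms continuous_on_tendsto_compose[of UNIV f x l F] by simp

lemma smooth_differentiable: "smooth X \<Longrightarrow> gateaux_differentiable (iter_gateaux X Ss) u S"
  by (simp add: smooth_def)

text \<open>Joint continuity in \<open>smooth\<close> concerns infinite sequences of directions. A
  finite list of converging directions is padded with zeros, and convergence of the resulting
  sequences is componentwise.\<close>

lemma smooth_iter_tendsto: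
  assumes X: "smooth X" and a: "(a \<longlongrightarrow> a0) F"
    and bs: "list_all2 (\<lambda>b l. (b \<longlongrightarrow> l) F) bs ls"
  shows "((\<lambda>i. iter_gateaux X (map (\<lambda>b. b i) bs) (a i)) \<longlongrightarrow> iter_gateaux X ls a0) F"
proof -
  define m where "m = length bs"
  have len: "length ls = m" using bs by (simp add: m_def list_all2_lengthD)
  define \<sigma> where "\<sigma> i k = (if k < m then (bs ! k) i else 0)" for i k
  define \<tau> where "\<tau> k = (if k < m then ls ! k else 0)" for k
  have "(\<sigma> \<longlongrightarrow> \<tau>) F"
    unfolding tendsto_fun_iff using bs by (auto simp: \<sigma>_def \<tau>_def m_def list_all2_conv_all_nth)
  with a have "((\<lambda>i. (a i, \<sigma> i)) \<longlongrightarrow> (a0, \<tau>)) F" by (rule tendsto_Pair)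
  moreover have "continuous_on UNIV (\<lambda>(u, \<sigma> :: nat \<Rightarrow> 'a). iter_gateaux X (map \<sigma> [0..<m]) u)"
    using X by (simp add: smooth_def)
  ultimately have "((\<lambda>i. iter_gateaux X (map (\<sigma> i) [0..<m]) (a i)) \<longlongrightarrow>
      iter_gateaux X (map \<tau> [0..<m]) a0) F"
    using continuous_on_UNIV_tendsto by fastforce
  moreover have "map (\<sigma> i) [0..<m] = map (\<lambda>b. b i) bs" for i
    by (rule nth_equalityI) (auto simp: m_def \<sigma>_def)
  moreover have "map \<tau> [0..<m] = ls"
    by (rule nth_equalityI) (auto simp: len \<tau>_def)
  ultimately show ?thesis by simp
qed

text \<open>Continuous directional derivatives give more than limits along fixed lines: by the mean
  value argument, base point, direction and the earlier directions may converge while the step tends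
  to zero. Additivity in the directions and the chain rule both rest on this.\<close>

lemma smooth_difference_quotient:
  assumes X: "smooth X" and x: "(x \<longlongrightarrow> x0) F" and y: "(y \<longlongrightarrow> y0) F"
    and t: "(t \<longlongrightarrow> (0::real)) F" "\<forall>\<^sub>F i in F. t i \<noteq> 0"
    and bs: "list_all2 (\<lambda>b l. (b \<longlongrightarrow> l) F) bs ls"
  shows "((\<lambda>i. (iter_gateaux X (map (\<lambda>b. b i) bs) (x i + t i *\<^sub>R y i) -
      iter_gateaux X (map (\<lambda>b. b i) bs) (x i)) /\<^sub>R t i) \<longlongrightarrow> iter_gateaux X (y0 # ls) x0) F"
proof (rule difference_quotient_tendsto[OF _ _ t(2)])
  show "((\<lambda>\<epsilon>::real. (iter_gateaux X (map (\<lambda>b. b i) bs) (u + \<epsilon> *\<^sub>R y i) -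
      iter_gateaux X (map (\<lambda>b. b i) bs) u) /\<^sub>R \<epsilon>) \<longlongrightarrow>
      iter_gateaux X (map (\<lambda>b. b i) (y # bs)) u) (at 0)" for i u
    using gateaux_tendsto[OF smooth_differentiable[OF X]] by simp
next
  let ?G = "F \<times>\<^sub>F principal {0..1::real}"
  have fst: "filterlim fst F ?G" by (rule filterlim_fst)
  have lift: "((\<lambda>z. b (fst z)) \<longlongrightarrow> l) ?G" if "(b \<longlongrightarrow> l) F" for b :: "_ \<Rightarrow> 'z::topological_space" and l
    using filterlim_compose[OF that fst] .
  \<comment> \<open>Since the second component stays in \<open>[0, 1]\<close>, the intermediate
    points converge to \<open>x0\<close> uniformly along the segment.\<close>
  have "\<forall>\<^sub>F z in ?G. \<bar>snd z * t (fst z)\<bar> \<le> \<bar>t (fst z)\<bar>"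
    unfolding eventually_prod_filter eventually_principal
    by (rule exI[of _ "\<lambda>_. True"], rule exI[of _ "\<lambda>\<theta>. \<theta> \<in> {0..1}"])
      (auto simp: abs_mult mult_left_le_one_le)
  then have "((\<lambda>z. snd z * t (fst z)) \<longlongrightarrow> 0) ?G"
    using tendsto_0_le[OF lift[OF t(1)], of "\<lambda>z. snd z * t (fst z)" 1] by simp
  then have "((\<lambda>z. x (fst z) + (snd z * t (fst z)) *\<^sub>R y (fst z)) \<longlongrightarrow> x0 + 0 *\<^sub>R y0) ?G"
    by (intro tendsto_add tendsto_scaleR_lctvs lift x y)
  then have pt: "((\<lambda>z. x (fst z) + (snd z * t (fst z)) *\<^sub>R y (fst z)) \<longlongrightarrow> x0) ?G"
    by simp
  have dirs: "list_all2 (\<lambda>b l. (b \<longlongrightarrow> l) ?G) (map (\<lambda>b z. b (fst z)) (y # bs)) (y0 # ls)"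
    using lift[OF y] list_all2_mono[OF bs lift] by (simp add: list_all2_map1)
  from smooth_iter_tendsto[OF X pt dirs] show "((\<lambda>(i, \<theta>). iter_gateaux X (map (\<lambda>b. b i) (y # bs)) (x i + (\<theta> * t i) *\<^sub>R y i))
      \<longlongrightarrow> iter_gateaux X (y0 # ls) x0) ?G"
    by (simp add: case_prod_unfold comp_def)
qed

section \<open>Multilinearity of iterated derivatives and differentiation along curves\<close>

lemma gateaux_add:
  assumes "gateaux_differentiable X u S" "gateaux_differentiable Y u S"
  shows "gateaux (\<lambda>v. X v + Y v) u S = gateaux X u S + gateaux Y u S"
  using tendsto_add[OF assms[THEN gateaux_tendsto]]
  by (intro gateauxI) (simp add: algebra_simps)

lemma tendsto_scaleR_left_const:
  "(f \<longlongrightarrow> l) F \<Longrightarrow> ((\<lambda>i. c *\<^sub>R f i) \<longlongrightarrow> c *\<^sub>R (l::'a::lctvs)) F"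
  by (intro tendsto_scaleR_lctvs tendsto_const)

lemma gateaux_scaleR:
  assumes "gateaux_differentiable X u S"
  shows "gateaux (\<lambda>v. c *\<^sub>R X v) u S = c *\<^sub>R gateaux X u S"
  using tendsto_scaleR_left_const[OF gateaux_tendsto[OF assms], of c]
  by (intro gateauxI) (simp add: algebra_simps)

text \<open>For the outermost direction, additivity splits the increment along \<open>S + T\<close>
  at the moving point \<open>u + \<epsilon> *\<^sub>R S\<close>, and homogeneity rescales the step.
  The directions in \<open>As\<close> are applied afterwards and preserve linear
  combinations.\<close>

lemma linear_iter_gateaux_slot:
  assumes X: "smooth X"
  shows "linear (\<lambda>S. iter_gateaux X (As @ S # Bs) u)"
proof (induction As arbitrary: u)
  case Nil
  define Y where "Y = iter_gateaux X Bs"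
  have Y: "((\<lambda>\<epsilon>::real. (Y (u + \<epsilon> *\<^sub>R S) - Y u) /\<^sub>R \<epsilon>) \<longlongrightarrow> gateaux Y u S) (at 0)" for u S
    unfolding Y_def by (intro gateaux_tendsto smooth_differentiable X)
  have "gateaux Y u (S + T) = gateaux Y u S + gateaux Y u T" for S T
  proof (rule gateauxI)
    have cst: "map (\<lambda>b. b i) (map (\<lambda>B (_::real). B) Bs) = Bs" for i
      by (simp add: comp_def)
    have all: "list_all2 (\<lambda>b l. (b \<longlongrightarrow> l) (at (0::real))) (map (\<lambda>B _. B) Bs) Bs"
      by (simp add: list_all2_conv_all_nth)
    have "((\<lambda>\<epsilon>::real. u + \<epsilon> *\<^sub>R S) \<longlongrightarrow> u + 0 *\<^sub>R S) (at 0)"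
      by (intro tendsto_add tendsto_scaleR_lctvs tendsto_ident_at tendsto_const)
    from smooth_difference_quotient[OF X this tendsto_const tendsto_ident_at _ all]
    have "((\<lambda>\<epsilon>::real. (Y (u + \<epsilon> *\<^sub>R S + \<epsilon> *\<^sub>R T) - Y (u + \<epsilon> *\<^sub>R S)) /\<^sub>R \<epsilon>) \<longlongrightarrow> gateaux Y u T) (at 0)"
      unfolding cst by (simp add: Y_def eventually_at_filter)
    from tendsto_add[OF Y[of u S] this]
    show "((\<lambda>\<epsilon>::real. (Y (u + \<epsilon> *\<^sub>R (S + T)) - Y u) /\<^sub>R \<epsilon>) \<longlongrightarrow> gateaux Y u S + gateaux Y u T) (at 0)"
      by (simp add: algebra_simps)
  qed
  moreover have "gateaux Y u (r *\<^sub>R S) = r *\<^sub>R gateaux Y u S" for r S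
  proof (rule gateauxI, cases "r = 0")
    case False
    then have "filterlim (\<lambda>h. h * r) (at 0) (at 0)"
      by (intro filterlim_atI tendsto_eq_intros) (auto simp: eventually_at_filter)
    from filterlim_compose[OF Y[of u S] this]
    have "((\<lambda>\<epsilon>::real. r *\<^sub>R ((Y (u + (\<epsilon> * r) *\<^sub>R S) - Y u) /\<^sub>R (\<epsilon> * r))) \<longlongrightarrow> r *\<^sub>R gateaux Y u S) (at 0)"
      by (rule tendsto_scaleR_left_const)
    then show "((\<lambda>\<epsilon>::real. (Y (u + \<epsilon> *\<^sub>R r *\<^sub>R S) - Y u) /\<^sub>R \<epsilon>) \<longlongrightarrow> r *\<^sub>R gateaux Y u S) (at 0)"
      using False by (simp add: field_simps)
  qed simp
  ultimately show ?case by (auto simp: Y_def intro: linearI)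
next
  case (Cons A As)
  have "iter_gateaux X (As @ (S + T) # Bs) =
      (\<lambda>v. iter_gateaux X (As @ S # Bs) v + iter_gateaux X (As @ T # Bs) v)"
    and "iter_gateaux X (As @ (r *\<^sub>R S) # Bs) = (\<lambda>v. r *\<^sub>R iter_gateaux X (As @ S # Bs) v)" for S T r
    using linear_add[OF Cons.IH] linear_cmul[OF Cons.IH] by fast+
  then show ?case
    by (intro linearI) (simp_all add: gateaux_add gateaux_scaleR smooth_differentiable[OF X])
qed

lemma differentiable_curve_tendsto:
  fixes b :: "real \<Rightarrow> 'b::lctvs"
  assumes "((\<lambda>\<epsilon>. (b \<epsilon> - b 0) /\<^sub>R \<epsilon>) \<longlongrightarrow> d) (at 0)"
  shows "(b \<longlongrightarrow> b 0) (at 0)"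
proof -
  have "((\<lambda>\<epsilon>. b 0 + \<epsilon> *\<^sub>R ((b \<epsilon> - b 0) /\<^sub>R \<epsilon>)) \<longlongrightarrow> b 0 + 0 *\<^sub>R d) (at 0)"
    by (intro tendsto_add tendsto_const tendsto_scaleR_lctvs tendsto_ident_at assms)
  moreover have "\<forall>\<^sub>F \<epsilon> in at 0. b 0 + \<epsilon> *\<^sub>R ((b \<epsilon> - b 0) /\<^sub>R \<epsilon>) = b \<epsilon>"
    by (simp add: eventually_at_filter)
  ultimately show ?thesis
    by (auto intro: Lim_transform_eventually)
qed

text \<open>Telescoping: the directions are replaced by their values at 0 one at a time. Linearity
  moves the quotient into the changing slot, and joint continuity gives its limit. The list
  \<open>As\<close> collects the slots that are already fixed.\<close>

lemma directions_difference_quotient: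
  assumes X: "smooth X"
    and "list_all2 (\<lambda>b d. ((\<lambda>\<epsilon>::real. (b \<epsilon> - b 0) /\<^sub>R \<epsilon>) \<longlongrightarrow> d) (at 0)) bs ds"
  shows "((\<lambda>\<epsilon>. (iter_gateaux X (As @ map (\<lambda>b. b \<epsilon>) bs) a - iter_gateaux X (As @ map (\<lambda>b. b 0) bs) a) /\<^sub>R \<epsilon>)
    \<longlongrightarrow> (\<Sum>k<length bs. iter_gateaux X (As @ (map (\<lambda>b. b 0) bs)[k := ds ! k]) a)) (at 0)"
  using assms(2)
proof (induction arbitrary: As rule: list_all2_induct)
  case Nil
  show ?case by simp
next
  case (Cons b bs d ds)
  let ?q = "\<lambda>\<epsilon>. (b \<epsilon> - b 0) /\<^sub>R \<epsilon>" and ?bs = "\<lambda>\<epsilon>. map (\<lambda>b. b \<epsilon>) bs"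
  have "list_all2 (\<lambda>b l. (b \<longlongrightarrow> l) (at 0)) bs (?bs 0)"
    using Cons.hyps differentiable_curve_tendsto
    by (fastforce simp: list_all2_conv_all_nth)
  then have "list_all2 (\<lambda>b l. (b \<longlongrightarrow> l) (at 0)) (map (\<lambda>A _. A) As @ ?q # bs) (As @ d # ?bs 0)"
    using Cons.hyps(1) by (auto intro!: list_all2_appendI simp: list_all2_map1 list_all2_same)
  from smooth_iter_tendsto[OF X tendsto_const this]
  have "((\<lambda>\<epsilon>. iter_gateaux X (As @ ?q \<epsilon> # ?bs \<epsilon>) a) \<longlongrightarrow> iter_gateaux X (As @ d # ?bs 0) a) (at 0)"
    by (simp add: comp_def)
  from tendsto_add[OF this Cons.IH[of "As @ [b 0]"]]
  have "((\<lambda>\<epsilon>. iter_gateaux X (As @ ?q \<epsilon> # ?bs \<epsilon>) a +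
      (iter_gateaux X (As @ b 0 # ?bs \<epsilon>) a - iter_gateaux X (As @ b 0 # ?bs 0) a) /\<^sub>R \<epsilon>)
    \<longlongrightarrow> iter_gateaux X (As @ d # ?bs 0) a +
      (\<Sum>k<length bs. iter_gateaux X (As @ b 0 # (?bs 0)[k := ds ! k]) a)) (at 0)"
    by simp
  moreover have "iter_gateaux X (As @ ?q \<epsilon> # ?bs \<epsilon>) a =
      (iter_gateaux X (As @ b \<epsilon> # ?bs \<epsilon>) a - iter_gateaux X (As @ b 0 # ?bs \<epsilon>) a) /\<^sub>R \<epsilon>" for \<epsilon>
    using linear_cmul[OF linear_iter_gateaux_slot[OF X], of As "inverse \<epsilon>" "b \<epsilon> - b 0" "?bs \<epsilon>" a]
      linear_diff[OF linear_iter_gateaux_slot[OF X], of As "b \<epsilon>" "b 0" "?bs \<epsilon>" a]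
    by (simp only:)
  ultimately show ?case
    by (simp add: sum.lessThan_Suc_shift scaleR_diff_right del: sum.lessThan_Suc)
qed

text \<open>The increment is split in two: first the base point moves while the directions stay at
  their values at \<open>\<epsilon>\<close>, then the directions move at the fixed base point
  \<open>a 0\<close>.\<close>

lemma iter_gateaux_difference_quotient:
  assumes X: "smooth X"
    and a: "((\<lambda>\<epsilon>::real. (a \<epsilon> - a 0) /\<^sub>R \<epsilon>) \<longlongrightarrow> a') (at 0)"
    and bs: "list_all2 (\<lambda>b d. ((\<lambda>\<epsilon>::real. (b \<epsilon> - b 0) /\<^sub>R \<epsilon>) \<longlongrightarrow> d) (at 0)) bs ds"
  shows "((\<lambda>\<epsilon>. (iter_gateaux X (map (\<lambda>b. b \<epsilon>) bs) (a \<epsilon>) - iter_gateaux X (map (\<lambda>b. b 0) bs) (a 0)) /\<^sub>R \<epsilon>)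
    \<longlongrightarrow> iter_gateaux X (a' # map (\<lambda>b. b 0) bs) (a 0) +
      (\<Sum>k<length bs. iter_gateaux X ((map (\<lambda>b. b 0) bs)[k := ds ! k]) (a 0))) (at 0)"
proof -
  let ?bs = "\<lambda>\<epsilon>. map (\<lambda>b. b \<epsilon>) bs"
  have "list_all2 (\<lambda>b l. (b \<longlongrightarrow> l) (at 0)) bs (?bs 0)"
    using bs differentiable_curve_tendsto by (fastforce simp: list_all2_conv_all_nth)
  from smooth_difference_quotient[OF X tendsto_const a tendsto_ident_at _ this, of "a 0"]
  have "((\<lambda>\<epsilon>. (iter_gateaux X (?bs \<epsilon>) (a 0 + \<epsilon> *\<^sub>R ((a \<epsilon> - a 0) /\<^sub>R \<epsilon>)) - iter_gateaux X (?bs \<epsilon>) (a 0)) /\<^sub>R \<epsilon>)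
      \<longlongrightarrow> iter_gateaux X (a' # ?bs 0) (a 0)) (at 0)"
    by (simp add: eventually_at_filter)
  moreover have "\<forall>\<^sub>F \<epsilon> in at 0. (iter_gateaux X (?bs \<epsilon>) (a 0 + \<epsilon> *\<^sub>R ((a \<epsilon> - a 0) /\<^sub>R \<epsilon>)) -
      iter_gateaux X (?bs \<epsilon>) (a 0)) /\<^sub>R \<epsilon> =
      (iter_gateaux X (?bs \<epsilon>) (a \<epsilon>) - iter_gateaux X (?bs \<epsilon>) (a 0)) /\<^sub>R \<epsilon>"
    by (simp add: eventually_at_filter)
  ultimately have "((\<lambda>\<epsilon>. (iter_gateaux X (?bs \<epsilon>) (a \<epsilon>) - iter_gateaux X (?bs \<epsilon>) (a 0)) /\<^sub>R \<epsilon>)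
      \<longlongrightarrow> iter_gateaux X (a' # ?bs 0) (a 0)) (at 0)"
    by (rule Lim_transform_eventually)
  from tendsto_add[OF this directions_difference_quotient[OF X bs, of "[]" "a 0"]]
  show ?thesis by (simp add: algebra_simps)
qed

section \<open>Smooth families\<close>

text \<open>Derivatives of composites are sums of terms \<open>D\<^sup>m g (f\<^sub>0; f\<^sub>1, \<dots>, f\<^sub>m)\<close> in which the \<open>f\<^sub>i\<close> depend on the
  directions already used. To keep the type fixed under differentiation, a family carries an infinite
  stream of directions as a parameter; differentiating consumes its head.\<close>

definition family_deriv ::
    "((nat \<Rightarrow> 'a::real_vector) \<Rightarrow> 'a \<Rightarrow> 'b::lctvs) \<Rightarrow> (nat \<Rightarrow> 'a) \<Rightarrow> 'a \<Rightarrow> 'b" where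
  "family_deriv F \<sigma> u = gateaux (F (\<lambda>k. \<sigma> (Suc k))) u (\<sigma> 0)"

text \<open>Differentiability of order \<open>n\<close> is defined by recursion, so that closure
  under an operation follows from computing one derivative and applying the induction hypothesis to
  it.\<close>

primrec smooth_family :: "nat \<Rightarrow> ((nat \<Rightarrow> 'a::lctvs) \<Rightarrow> 'a \<Rightarrow> 'b::lctvs) \<Rightarrow> bool" where
  "smooth_family 0 F \<longleftrightarrow> continuous_on UNIV (\<lambda>(u, \<sigma>). F \<sigma> u)"
| "smooth_family (Suc n) F \<longleftrightarrow> continuous_on UNIV (\<lambda>(u, \<sigma>). F \<sigma> u) \<and>
     (\<forall>\<sigma> u S. gateaux_differentiable (F \<sigma>) u S) \<and> smooth_family n (family_deriv F)"

lemma smooth_family_iff: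
  "smooth_family n F \<longleftrightarrow>
     (\<forall>k<Suc n. continuous_on UNIV (\<lambda>(u, \<sigma>). (family_deriv ^^ k) F \<sigma> u)) \<and>
     (\<forall>k<n. \<forall>\<sigma> u S. gateaux_differentiable ((family_deriv ^^ k) F \<sigma>) u S)"
proof (induction n arbitrary: F)
  case 0
  show ?case by simp
next
  case (Suc n)
  show ?case
    unfolding smooth_family.simps Suc.IH All_less_Suc2[of "Suc n"] All_less_Suc2[of n]
    by (simp add: funpow_Suc_right del: funpow.simps) auto
qed

lemma family_deriv_funpow:
  "(family_deriv ^^ k) (\<lambda>\<sigma>. X) = (\<lambda>\<sigma>. iter_gateaux X (map \<sigma> [0..<k]))"
proof (induction k)
  case (Suc k)
  have "map \<sigma> [0..<Suc k] = \<sigma> 0 # map (\<lambda>k. \<sigma> (Suc k)) [0..<k]" for \<sigma> :: "nat \<Rightarrow> 'a"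
    by (simp add: upt_conv_Cons map_Suc_upt[symmetric] comp_def del: upt_Suc)
  then show ?case
    unfolding funpow.simps comp_def Suc.IH by (simp add: family_deriv_def fun_eq_iff del: upt_Suc)
qed simp

text \<open>On a family that ignores its stream, \<open>k\<close> applications of
  \<open>family_deriv\<close> give the iterated derivative along the first \<open>k\<close>
  directions, and every finite list is an initial segment of a stream.\<close>

lemma smooth_iff_smooth_family: "smooth X \<longleftrightarrow> (\<forall>n. smooth_family n (\<lambda>\<sigma>. X))"
proof -
  have "(\<forall>Ss u S. gateaux_differentiable (iter_gateaux X Ss) u S) \<longleftrightarrow>
      (\<forall>k \<sigma> u S. gateaux_differentiable (iter_gateaux X (map \<sigma> [0..<k])) u S)"
    (is "?L \<longleftrightarrow> ?R")
  proof
    assume ?R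
    then show ?L
      by (intro allI) (subst map_nth[symmetric], blast)
  qed blast
  then show ?thesis
    unfolding smooth_def smooth_family_iff family_deriv_funpow by blast
qed

lemma smooth_family_continuous: "smooth_family n F \<Longrightarrow> continuous_on UNIV (\<lambda>(u, \<sigma>). F \<sigma> u)"
  by (cases n) auto

lemma smooth_family_tendsto:
  "smooth_family n F \<Longrightarrow> ((\<lambda>(u, \<sigma>). F \<sigma> u) \<longlongrightarrow> F \<sigma> u) (at (u, \<sigma>))"
  using smooth_family_continuous[of n F] by (fastforce simp: continuous_on_def)

lemma continuous_family_tendstoI:
  "(\<And>u \<sigma>. ((\<lambda>(u, \<sigma>). F \<sigma> u) \<longlongrightarrow> F \<sigma> u) (at (u, \<sigma>))) \<Longrightarrow> continuous_on UNIV (\<lambda>(u, \<sigma>). F \<sigma> u)"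
  by (auto simp: continuous_on_def)

text \<open>The stream \<open>case_nat S \<sigma>\<close> has head \<open>S\<close> and tail
  \<open>\<sigma>\<close>, so a derivative along the heads of all streams covers every direction
  together with every remaining stream.\<close>

lemma smooth_family_SucI:
  assumes "continuous_on UNIV (\<lambda>(u, \<sigma>). F \<sigma> u)"
    and G: "\<And>\<sigma> u. ((\<lambda>\<epsilon>::real. (F (\<lambda>k. \<sigma> (Suc k)) (u + \<epsilon> *\<^sub>R \<sigma> 0) - F (\<lambda>k. \<sigma> (Suc k)) u) /\<^sub>R \<epsilon>) \<longlongrightarrow> G \<sigma> u) (at 0)"
    and "smooth_family n G"
  shows "smooth_family (Suc n) F"
proof -
  have "gateaux_differentiable (F \<sigma>) u S" for \<sigma> u S
    using G[of "case_nat S \<sigma>" u] unfolding gateaux_differentiable_def by (auto simp: comp_def)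
  moreover have "family_deriv F = G"
    using gateauxI[OF G] by (simp add: fun_eq_iff family_deriv_def)
  ultimately show ?thesis using assms by simp
qed

lemma smooth_family_SucD:
  assumes "smooth_family (Suc n) F"
  shows "((\<lambda>\<epsilon>::real. (F (\<lambda>k. \<sigma> (Suc k)) (u + \<epsilon> *\<^sub>R \<sigma> 0) - F (\<lambda>k. \<sigma> (Suc k)) u) /\<^sub>R \<epsilon>) \<longlongrightarrow> family_deriv F \<sigma> u) (at 0)"
    and "smooth_family n (family_deriv F)"
  using assms by (auto simp: family_deriv_def[of F] intro: gateaux_tendsto)

lemma smooth_family_Suc_lower: "smooth_family (Suc n) F \<Longrightarrow> smooth_family n F"
  by (induction n arbitrary: F) auto

text \<open>Differentiation turns the reindexing \<open>\<rho>\<close> into the map that fixes 0 and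
  sends \<open>Suc j\<close> to \<open>Suc (\<rho> j)\<close>; hence the induction runs over all
  \<open>\<rho>\<close> at once. The shift by one, which appears in product and chain rules, is a
  special case.\<close>

lemma smooth_family_reindex:
  assumes "smooth_family n F"
  shows "smooth_family n (\<lambda>\<sigma>. F (\<lambda>k. \<sigma> (\<rho> k)))"
proof -
  have c: "continuous_on UNIV (\<lambda>(u, \<sigma>). F (\<lambda>k. \<sigma> (\<rho> k)) u)"
    if "continuous_on UNIV (\<lambda>(u, \<sigma>). F \<sigma> u)"
    for F :: "(nat \<Rightarrow> 'a) \<Rightarrow> 'a \<Rightarrow> 'b" and \<rho> :: "nat \<Rightarrow> nat"
  proof (rule continuous_family_tendstoI)
    fix u :: 'a and \<sigma> :: "nat \<Rightarrow> 'a"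
    have "((\<lambda>x. x) \<longlongrightarrow> (u, \<sigma>)) (at (u, \<sigma>))" by (rule tendsto_ident_at)
    then have "((\<lambda>x. (fst x, \<lambda>k. snd x (\<rho> k))) \<longlongrightarrow> (u, \<lambda>k. \<sigma> (\<rho> k))) (at (u, \<sigma>))"
      using tendsto_snd[of "\<lambda>x. x" "(u, \<sigma>)"] tendsto_fst[of "\<lambda>x. x" "(u, \<sigma>)"]
      by (intro tendsto_Pair) (auto simp: tendsto_fun_iff)
    from continuous_on_UNIV_tendsto[OF that this]
    show "((\<lambda>(u, \<sigma>). F (\<lambda>k. \<sigma> (\<rho> k)) u) \<longlongrightarrow> F (\<lambda>k. \<sigma> (\<rho> k)) u) (at (u, \<sigma>))"
      by (simp add: case_prod_unfold)
  qed
  show ?thesis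
    using assms
  proof (induction n arbitrary: F \<rho>)
    case (Suc n)
    have "family_deriv (\<lambda>\<sigma>. F (\<lambda>k. \<sigma> (\<rho> k))) =
        (\<lambda>\<sigma>. family_deriv F (\<lambda>k. \<sigma> (case k of 0 \<Rightarrow> 0 | Suc j \<Rightarrow> Suc (\<rho> j))))"
      by (simp add: family_deriv_def fun_eq_iff)
    then show ?case using Suc c by simp
  qed (simp add: c)
qed

section \<open>Closure of smooth families under algebraic operations and composition\<close>

lemma smooth_family_const: "smooth_family n (\<lambda>\<sigma> u. c)"
proof (induction n arbitrary: c)
  case (Suc n)
  show ?case by (rule smooth_family_SucI[where G = "\<lambda>_ _. 0"]) (simp_all add: Suc case_prod_unfold)
qed (simp add: case_prod_unfold)

lemma smooth_family_direction: "smooth_family n (\<lambda>\<sigma> u. \<sigma> k)"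
proof -
  have c: "continuous_on UNIV (\<lambda>(u, \<sigma>). \<sigma> k)"
    unfolding case_prod_unfold
    by (rule continuous_on_product_then_coordinatewise[OF continuous_on_snd[OF continuous_on_id]])
  show ?thesis
  proof (cases n)
    case (Suc m)
    show ?thesis
      unfolding Suc
    proof (rule smooth_family_SucI)
      show "((\<lambda>\<epsilon>::real. (\<sigma> (Suc k) - \<sigma> (Suc k)) /\<^sub>R \<epsilon>) \<longlongrightarrow> 0) (at 0)" for \<sigma> :: "nat \<Rightarrow> 'a"
        by simp
    qed (rule c smooth_family_const)+
  qed (simp add: c)
qed

lemma smooth_family_ident: "smooth_family n (\<lambda>\<sigma> u. u)"
proof -
  have c: "continuous_on UNIV (\<lambda>(u, \<sigma>). u)"
    unfolding case_prod_unfold by (intro continuous_on_fst continuous_on_id)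
  show ?thesis
  proof (cases n)
    case (Suc m)
    have "((\<lambda>\<epsilon>::real. (u + \<epsilon> *\<^sub>R S - u) /\<^sub>R \<epsilon>) \<longlongrightarrow> S) (at 0)" for u S :: 'a
      by (rule tendsto_eventually) (simp add: eventually_at_filter)
    then show ?thesis
      unfolding Suc by (rule smooth_family_SucI[OF c]) (rule smooth_family_direction)
  qed (simp add: c)
qed

lemma smooth_family_linear:
  assumes "linear L" "continuous_on UNIV L" "smooth_family n F"
  shows "smooth_family n (\<lambda>\<sigma> u. L (F \<sigma> u))"
  using assms(3)
proof (induction n arbitrary: F)
  case 0
  then show ?case
    using continuous_on_compose2[OF assms(2), of UNIV "\<lambda>(u, \<sigma>). F \<sigma> u"] by (simp add: case_prod_unfold)
next
  case (Suc n)
  show ?case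
  proof (rule smooth_family_SucI)
    show "continuous_on UNIV (\<lambda>(u, \<sigma>). L (F \<sigma> u))"
      using continuous_on_compose2[OF assms(2) smooth_family_continuous[OF Suc.prems]]
      by (simp add: case_prod_unfold)
    show "((\<lambda>\<epsilon>::real. (L (F (\<lambda>k. \<sigma> (Suc k)) (u + \<epsilon> *\<^sub>R \<sigma> 0)) - L (F (\<lambda>k. \<sigma> (Suc k)) u)) /\<^sub>R \<epsilon>)
        \<longlongrightarrow> L (family_deriv F \<sigma> u)) (at 0)" for \<sigma> u
      using continuous_on_UNIV_tendsto[OF assms(2) smooth_family_SucD(1)[OF Suc.prems]]
      by (simp add: linear_cmul[OF assms(1)] linear_diff[OF assms(1)])
  qed (intro Suc.IH smooth_family_SucD(2)[OF Suc.prems])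
qed

lemma smooth_family_Pair:
  assumes "smooth_family n F" "smooth_family n G"
  shows "smooth_family n (\<lambda>\<sigma> u. (F \<sigma> u, G \<sigma> u))"
  using assms
proof (induction n arbitrary: F G)
  case 0
  then show ?case using continuous_on_Pair by (fastforce simp: case_prod_unfold)
next
  case (Suc n)
  show ?case
  proof (rule smooth_family_SucI)
    show "continuous_on UNIV (\<lambda>(u, \<sigma>). (F \<sigma> u, G \<sigma> u))"
      using continuous_on_Pair[OF Suc.prems[THEN smooth_family_continuous]]
      by (simp add: case_prod_unfold)
    show "((\<lambda>\<epsilon>::real. ((F (\<lambda>k. \<sigma> (Suc k)) (u + \<epsilon> *\<^sub>R \<sigma> 0), G (\<lambda>k. \<sigma> (Suc k)) (u + \<epsilon> *\<^sub>R \<sigma> 0)) -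
        (F (\<lambda>k. \<sigma> (Suc k)) u, G (\<lambda>k. \<sigma> (Suc k)) u)) /\<^sub>R \<epsilon>)
        \<longlongrightarrow> (family_deriv F \<sigma> u, family_deriv G \<sigma> u)) (at 0)" for \<sigma> u
      using tendsto_Pair[OF Suc.prems[THEN smooth_family_SucD(1)]] by simp
  qed (intro Suc.IH Suc.prems[THEN smooth_family_SucD(2)])
qed

lemma smooth_family_vec_lambda:
  fixes F :: "'i::finite \<Rightarrow> (nat \<Rightarrow> 'a::lctvs) \<Rightarrow> 'a \<Rightarrow> 'b::lctvs"
  assumes "\<And>i. smooth_family n (F i)"
  shows "smooth_family n (\<lambda>\<sigma> u. \<chi> i. F i \<sigma> u)"
proof -
  have c: "continuous_on UNIV (\<lambda>(u, \<sigma>). \<chi> i. F i \<sigma> u)"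
    if "\<And>i. smooth_family n (F i)" for F :: "'i \<Rightarrow> (nat \<Rightarrow> 'a) \<Rightarrow> 'a \<Rightarrow> 'b" and n
    using smooth_family_tendsto[OF that]
    by (intro continuous_family_tendstoI) (auto simp: case_prod_unfold intro!: tendsto_vec_lambda)
  show ?thesis
    using assms
  proof (induction n arbitrary: F)
    case 0
    then show ?case using c[of 0 F] by simp
  next
    case (Suc n)
    show ?case
    proof (rule smooth_family_SucI)
      show "((\<lambda>\<epsilon>::real. ((\<chi> i. F i (\<lambda>k. \<sigma> (Suc k)) (u + \<epsilon> *\<^sub>R \<sigma> 0)) - (\<chi> i. F i (\<lambda>k. \<sigma> (Suc k)) u)) /\<^sub>R \<epsilon>)
          \<longlongrightarrow> (\<chi> i. family_deriv (F i) \<sigma> u)) (at 0)" for \<sigma> u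
        using tendsto_vec_lambda[OF smooth_family_SucD(1)[OF Suc.prems]]
        by (simp add: scaleR_vec_def minus_vec_def)
    qed (intro c[OF Suc.prems] Suc.IH smooth_family_SucD(2)[OF Suc.prems])+
  qed
qed

lemma smooth_family_add:
  assumes "smooth_family n F" "smooth_family n G"
  shows "smooth_family n (\<lambda>\<sigma> u. F \<sigma> u + G \<sigma> u)"
proof -
  have lin: "linear (\<lambda>x::'b \<times> 'b. fst x + snd x)"
    by (rule linearI) (simp_all add: algebra_simps)
  have "continuous_on UNIV (\<lambda>x::'b \<times> 'b. fst x + snd x)"
    by (intro continuous_intros)
  from smooth_family_linear[OF lin this smooth_family_Pair[OF assms]] show ?thesis by simp
qed

lemma smooth_family_sum:
  assumes "\<And>i. i \<in> I \<Longrightarrow> smooth_family n (F i)"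
  shows "smooth_family n (\<lambda>\<sigma> u. \<Sum>i\<in>I. F i \<sigma> u)"
  using assms
  by (induction I rule: infinite_finite_induct) (auto intro: smooth_family_const smooth_family_add)

lemma smooth_family_scaleR:
  assumes "smooth_family n F" "smooth_family n G"
  shows "smooth_family n (\<lambda>\<sigma> u. F \<sigma> u *\<^sub>R G \<sigma> u)"
proof -
  have c: "continuous_on UNIV (\<lambda>(u, \<sigma>). F \<sigma> u *\<^sub>R G \<sigma> u)"
    if "smooth_family n F" "smooth_family n G"
    for F :: "(nat \<Rightarrow> 'a) \<Rightarrow> 'a \<Rightarrow> real" and G :: "(nat \<Rightarrow> 'a) \<Rightarrow> 'a \<Rightarrow> 'b" and n
    using that[THEN smooth_family_tendsto]
    by (intro continuous_family_tendstoI) (auto simp: case_prod_unfold intro!: tendsto_scaleR_lctvs)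
  show ?thesis
    using assms
  proof (induction n arbitrary: F G)
    case 0
    then show ?case using c[of 0 F G] by simp
  next
    case (Suc n)
    note D = Suc.prems[THEN smooth_family_SucD(1)] and low = Suc.prems[THEN smooth_family_Suc_lower]
    show ?case
    proof (rule smooth_family_SucI)
      fix \<sigma> u
      let ?F = "\<lambda>\<epsilon>::real. F (\<lambda>k. \<sigma> (Suc k)) (u + \<epsilon> *\<^sub>R \<sigma> 0)" and ?G = "\<lambda>\<epsilon>::real. G (\<lambda>k. \<sigma> (Suc k)) (u + \<epsilon> *\<^sub>R \<sigma> 0)"
      have "(?G \<longlongrightarrow> ?G 0) (at 0)"
        using D(2)[of \<sigma> u] by (intro differentiable_curve_tendsto) simp
      then have "((\<lambda>\<epsilon>. ((?F \<epsilon> - ?F 0) /\<^sub>R \<epsilon>) *\<^sub>R ?G \<epsilon> + ?F 0 *\<^sub>R ((?G \<epsilon> - ?G 0) /\<^sub>R \<epsilon>))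
          \<longlongrightarrow> family_deriv F \<sigma> u *\<^sub>R ?G 0 + ?F 0 *\<^sub>R family_deriv G \<sigma> u) (at 0)"
        using D[of \<sigma> u] by (intro tendsto_add tendsto_scaleR_lctvs tendsto_const) simp_all
      then show "((\<lambda>\<epsilon>::real. (?F \<epsilon> *\<^sub>R ?G \<epsilon> - F (\<lambda>k. \<sigma> (Suc k)) u *\<^sub>R G (\<lambda>k. \<sigma> (Suc k)) u) /\<^sub>R \<epsilon>)
          \<longlongrightarrow> family_deriv F \<sigma> u *\<^sub>R G (\<lambda>k. \<sigma> (Suc k)) u + F (\<lambda>k. \<sigma> (Suc k)) u *\<^sub>R family_deriv G \<sigma> u) (at 0)"
        by (simp add: algebra_simps)
    qed (intro c[OF Suc.prems] smooth_family_add Suc.IH low[THEN smooth_family_reindex]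
        Suc.prems[THEN smooth_family_SucD(2)])+
  qed
qed

text \<open>Terms of this shape are closed under differentiation up to finite sums: the derivative
  either adds the derivative of \<open>f\<close> as a new direction or replaces one direction
  \<open>h\<close> by its derivative. Induction on \<open>n\<close> for all lists \<open>hs\<close>
  therefore avoids an explicit higher chain rule.\<close>

lemma smooth_family_iter_gateaux:
  assumes X: "smooth X" and "smooth_family n f" "\<forall>h\<in>set hs. smooth_family n h"
  shows "smooth_family n (\<lambda>\<sigma> u. iter_gateaux X (map (\<lambda>h. h \<sigma> u) hs) (f \<sigma> u))"
proof -
  have c: "continuous_on UNIV (\<lambda>(u, \<sigma>). iter_gateaux X (map (\<lambda>h. h \<sigma> u) hs) (f \<sigma> u))"
    if f: "smooth_family n f" and hs: "\<forall>h\<in>set hs. smooth_family n h" for n f hs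
  proof (rule continuous_family_tendstoI)
    fix u \<sigma>
    have "list_all2 (\<lambda>b l. (b \<longlongrightarrow> l) (at (u, \<sigma>)))
        (map (\<lambda>h (u, \<sigma>). h \<sigma> u) hs) (map (\<lambda>h. h \<sigma> u) hs)"
      using hs smooth_family_tendsto by (fastforce simp: list_all2_conv_all_nth)
    from smooth_iter_tendsto[OF X smooth_family_tendsto[OF f] this]
    show "((\<lambda>(u, \<sigma>). iter_gateaux X (map (\<lambda>h. h \<sigma> u) hs) (f \<sigma> u)) \<longlongrightarrow>
        iter_gateaux X (map (\<lambda>h. h \<sigma> u) hs) (f \<sigma> u)) (at (u, \<sigma>))"
      by (simp add: case_prod_unfold comp_def)
  qed
  show ?thesis
    using assms(2,3)
  proof (induction n arbitrary: f hs)
    case 0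
    then show ?case using c[of 0 f hs] by simp
  next
    case (Suc n)
    \<comment> \<open>The factors that are not differentiated see the stream after its head has been
      consumed.\<close>
    define sh where "sh = (\<lambda>h :: (nat \<Rightarrow> 'c) \<Rightarrow> 'c \<Rightarrow> 'a. \<lambda>\<sigma>. h (\<lambda>k. \<sigma> (Suc k)))"
    define T where "T = (\<lambda>hs \<sigma> u. iter_gateaux X (map (\<lambda>h. h \<sigma> u) hs) (sh f \<sigma> u))"
    have sh: "smooth_family n (sh h)" if "smooth_family (Suc n) h" for h
      unfolding sh_def by (rule smooth_family_reindex[OF smooth_family_Suc_lower[OF that]])
    have T: "smooth_family n (T hs)" if "\<forall>h\<in>set hs. smooth_family n h" for hs
      unfolding T_def by (intro Suc.IH sh Suc.prems that)
    show ?case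
    proof (rule smooth_family_SucI[where
          G = "\<lambda>\<sigma> u. T (family_deriv f # map sh hs) \<sigma> u +
            (\<Sum>k<length hs. T ((map sh hs)[k := family_deriv (hs ! k)]) \<sigma> u)"])
      fix \<sigma> u
      have "list_all2 (\<lambda>b d. ((\<lambda>\<epsilon>::real. (b \<epsilon> - b 0) /\<^sub>R \<epsilon>) \<longlongrightarrow> d) (at 0))
          (map (\<lambda>h \<epsilon>. h (\<lambda>k. \<sigma> (Suc k)) (u + \<epsilon> *\<^sub>R \<sigma> 0)) hs) (map (\<lambda>h. family_deriv h \<sigma> u) hs)"
        using Suc.prems(2) smooth_family_SucD(1) by (fastforce simp: list_all2_conv_all_nth simp del: smooth_family.simps)
      from iter_gateaux_difference_quotient[OF X _ this,
          of "\<lambda>\<epsilon>. f (\<lambda>k. \<sigma> (Suc k)) (u + \<epsilon> *\<^sub>R \<sigma> 0)" "family_deriv f \<sigma> u"]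
        smooth_family_SucD(1)[OF Suc.prems(1), of \<sigma> u]
      show "((\<lambda>\<epsilon>::real. (iter_gateaux X (map (\<lambda>h. h (\<lambda>k. \<sigma> (Suc k)) (u + \<epsilon> *\<^sub>R \<sigma> 0)) hs) (f (\<lambda>k. \<sigma> (Suc k)) (u + \<epsilon> *\<^sub>R \<sigma> 0)) -
          iter_gateaux X (map (\<lambda>h. h (\<lambda>k. \<sigma> (Suc k)) u) hs) (f (\<lambda>k. \<sigma> (Suc k)) u)) /\<^sub>R \<epsilon>)
        \<longlongrightarrow> T (family_deriv f # map sh hs) \<sigma> u +
            (\<Sum>k<length hs. T ((map sh hs)[k := family_deriv (hs ! k)]) \<sigma> u)) (at 0)"
        by (simp add: T_def sh_def comp_def map_update)
    next
      have "\<forall>h\<in>set (family_deriv f # map sh hs). smooth_family n h"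
        using Suc.prems sh smooth_family_SucD(2) by (auto simp del: smooth_family.simps)
      moreover have "\<forall>h\<in>set ((map sh hs)[k := family_deriv (hs ! k)]). smooth_family n h"
        if "k < length hs" for k
      proof -
        have "smooth_family n (family_deriv (hs ! k))"
          using Suc.prems(2) that smooth_family_SucD(2) nth_mem by blast
        then show ?thesis
          using set_update_subset_insert[of "map sh hs" k] Suc.prems(2) sh
          by (auto simp del: smooth_family.simps dest!: subsetD)
      qed
      ultimately show "smooth_family n (\<lambda>\<sigma> u. T (family_deriv f # map sh hs) \<sigma> u +
            (\<Sum>k<length hs. T ((map sh hs)[k := family_deriv (hs ! k)]) \<sigma> u))"
        by (intro smooth_family_add smooth_family_sum T) auto
    qed (intro c[OF Suc.prems])
  qed
qed

section \<open>Closure properties of smooth maps\<close>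

lemma smooth_iter_gateaux:
  assumes "smooth X" "smooth f" "\<forall>h\<in>set hs. smooth h"
  shows "smooth (\<lambda>x. iter_gateaux X (map (\<lambda>h. h x) hs) (f x))"
proof -
  have "smooth_family n (\<lambda>\<sigma> u. iter_gateaux X (map (\<lambda>h. h \<sigma> u) (map (\<lambda>h \<sigma>. h) hs)) ((\<lambda>\<sigma>. f) \<sigma> u))" for n
    using assms(2,3) by (intro smooth_family_iter_gateaux assms(1)) (auto simp: smooth_iff_smooth_family)
  then show ?thesis by (simp add: smooth_iff_smooth_family comp_def)
qed

lemma smooth_compose: "smooth X \<Longrightarrow> smooth f \<Longrightarrow> smooth (\<lambda>x. X (f x))"
  using smooth_iter_gateaux[of X f "[]"] by simp

lemma smooth_gateaux: "smooth X \<Longrightarrow> smooth f \<Longrightarrow> smooth h \<Longrightarrow> smooth (\<lambda>x. gateaux X (f x) (h x))"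
  using smooth_iter_gateaux[of X f "[h]"] by simp

lemma smooth_const: "smooth (\<lambda>x. c)"
  by (simp add: smooth_iff_smooth_family smooth_family_const)

lemma smooth_ident: "smooth (\<lambda>x. x)"
  by (simp add: smooth_iff_smooth_family smooth_family_ident)

lemma smooth_linear_compose: "linear L \<Longrightarrow> continuous_on UNIV L \<Longrightarrow> smooth f \<Longrightarrow> smooth (\<lambda>x. L (f x))"
  unfolding smooth_iff_smooth_family
  by (intro allI smooth_family_linear[where L = L and F = "\<lambda>_. f"]) auto

lemma smooth_Pair: "smooth f \<Longrightarrow> smooth g \<Longrightarrow> smooth (\<lambda>x. (f x, g x))"
  by (simp add: smooth_iff_smooth_family smooth_family_Pair)

lemma smooth_vec_lambda: "(\<And>i. smooth (f i)) \<Longrightarrow> smooth (\<lambda>x. \<chi> i. f i x)"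
  by (simp add: smooth_iff_smooth_family smooth_family_vec_lambda)

lemma smooth_add: "smooth f \<Longrightarrow> smooth g \<Longrightarrow> smooth (\<lambda>x. f x + g x)"
  by (simp add: smooth_iff_smooth_family smooth_family_add)

lemma smooth_sum: "(\<And>i. i \<in> I \<Longrightarrow> smooth (f i)) \<Longrightarrow> smooth (\<lambda>x. \<Sum>i\<in>I. f i x)"
  by (simp add: smooth_iff_smooth_family smooth_family_sum)

lemma smooth_scaleR: "smooth f \<Longrightarrow> smooth g \<Longrightarrow> smooth (\<lambda>x. f x *\<^sub>R g x)"
  by (simp add: smooth_iff_smooth_family smooth_family_scaleR)

lemma smooth_power:
  fixes f :: "'a::lctvs \<Rightarrow> real"
  shows "smooth f \<Longrightarrow> smooth (\<lambda>x. f x ^ n)"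
proof (induction n)
  case (Suc n)
  from smooth_scaleR[OF Suc.prems Suc.IH[OF Suc.prems]] show ?case by simp
qed (simp add: smooth_const)

lemma smooth_fst: "smooth f \<Longrightarrow> smooth (\<lambda>x. fst (f x))"
  by (rule smooth_linear_compose[OF linear_fst]) (intro continuous_intros)

lemma smooth_snd: "smooth f \<Longrightarrow> smooth (\<lambda>x. snd (f x))"
  by (rule smooth_linear_compose[OF linear_snd]) (intro continuous_intros)

lemma smooth_vec_nth: "smooth f \<Longrightarrow> smooth (\<lambda>x. f x $ i)"
  by (rule smooth_linear_compose[where L = "\<lambda>x. x $ i"])
    (simp_all add: linear_iff continuous_on_def tendsto_vec_nth)

section \<open>Calculus of iterated derivatives\<close>

text \<open>Both mixed second derivatives are limits of the same symmetric second difference quotient.\<close>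

lemma mixed_difference_tendsto:
  assumes Y: "smooth Y"
  shows "((\<lambda>\<epsilon>::real. (Y (u + \<epsilon> *\<^sub>R S + \<epsilon> *\<^sub>R T) - Y (u + \<epsilon> *\<^sub>R S) - Y (u + \<epsilon> *\<^sub>R T) + Y u) /\<^sub>R (\<epsilon> * \<epsilon>))
    \<longlongrightarrow> iter_gateaux Y [S, T] u) (at 0)"
proof -
  let ?X = "\<lambda>i v. (Y (v + i *\<^sub>R S) - Y v) /\<^sub>R i"
  let ?D = "\<lambda>i v. (gateaux Y (v + i *\<^sub>R S) T - gateaux Y v T) /\<^sub>R i"
  let ?G = "at 0 \<times>\<^sub>F principal {0..1::real}"
  have "((\<lambda>i. (?X i (u + i *\<^sub>R T) - ?X i u) /\<^sub>R i) \<longlongrightarrow> iter_gateaux Y [S, T] u) (at 0)"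
  \<comment> \<open>The map \<open>?X i\<close> itself depends on the step. Its derivative along
    \<open>T\<close> is the quotient, along \<open>S\<close>, of the derivative of \<open>Y\<close>
    along \<open>T\<close>; the limit of this quotient along moving base points is already
    known.\<close>
  proof (rule difference_quotient_tendsto)
    fix i :: real and v
    have D: "((\<lambda>\<epsilon>::real. (Y (w + \<epsilon> *\<^sub>R T) - Y w) /\<^sub>R \<epsilon>) \<longlongrightarrow> gateaux Y w T) (at 0)" for w
      using gateaux_tendsto[OF smooth_differentiable[OF Y, of "[]"]] by simp
    from tendsto_scaleR_left_const[OF tendsto_diff[OF D[of "v + i *\<^sub>R S"] D[of v]], of "inverse i"]
    show "((\<lambda>\<epsilon>. (?X i (v + \<epsilon> *\<^sub>R T) - ?X i v) /\<^sub>R \<epsilon>) \<longlongrightarrow> ?D i v) (at 0)"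
      by (simp add: algebra_simps)
  next
    have "filterlim fst (at 0) ?G" by (rule filterlim_fst)
    then have fst: "((\<lambda>z. fst z) \<longlongrightarrow> 0) ?G" "\<forall>\<^sub>F z in ?G. fst z \<noteq> 0"
      by (auto simp: filterlim_at)
    have "\<forall>\<^sub>F z in ?G. \<bar>snd z * fst z\<bar> \<le> \<bar>fst z\<bar>"
      unfolding eventually_prod_filter eventually_principal
      by (rule exI[of _ "\<lambda>_. True"], rule exI[of _ "\<lambda>\<theta>. \<theta> \<in> {0..1}"])
        (auto simp: abs_mult mult_left_le_one_le)
    then have "((\<lambda>z. snd z * fst z) \<longlongrightarrow> 0) ?G"
      using tendsto_0_le[OF fst(1), of "\<lambda>z. snd z * fst z" 1] by simp
    then have "((\<lambda>z. u + (snd z * fst z) *\<^sub>R T) \<longlongrightarrow> u + 0 *\<^sub>R T) ?G"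
      by (intro tendsto_add tendsto_scaleR_lctvs tendsto_const)
    from smooth_difference_quotient[OF Y this tendsto_const fst, of "[\<lambda>_. T]" "[T]" S]
    show "((\<lambda>(i, \<theta>). ?D i (u + (\<theta> * i) *\<^sub>R T)) \<longlongrightarrow> iter_gateaux Y [S, T] u) ?G"
      by (simp add: case_prod_unfold)
  qed (simp add: eventually_at_filter)
  then show ?thesis
    by (simp add: algebra_simps)
qed

lemma iter_gateaux_commute:
  assumes "smooth Y"
  shows "iter_gateaux Y [S, T] u = iter_gateaux Y [T, S] u"
proof -
  have "(\<lambda>\<epsilon>::real. (Y (u + \<epsilon> *\<^sub>R S + \<epsilon> *\<^sub>R T) - Y (u + \<epsilon> *\<^sub>R S) - Y (u + \<epsilon> *\<^sub>R T) + Y u) /\<^sub>R (\<epsilon> * \<epsilon>)) =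
      (\<lambda>\<epsilon>. (Y (u + \<epsilon> *\<^sub>R T + \<epsilon> *\<^sub>R S) - Y (u + \<epsilon> *\<^sub>R T) - Y (u + \<epsilon> *\<^sub>R S) + Y u) /\<^sub>R (\<epsilon> * \<epsilon>))"
    by (simp add: algebra_simps)
  with mixed_difference_tendsto[OF assms] show ?thesis
    by (metis (no_types, lifting) tendsto_unique at_neq_bot)
qed

lemma iter_gateaux_append: "iter_gateaux X (As @ Bs) = iter_gateaux (iter_gateaux X Bs) As"
  by (induction As) simp_all

lemma smooth_iter_gateaux_fixed:
  assumes "smooth X"
  shows "smooth (iter_gateaux X Ss)"
  using smooth_iter_gateaux[OF assms smooth_ident, of "map (\<lambda>S _. S) Ss"]
  by (auto simp: comp_def smooth_const)

text \<open>The outermost derivative along \<open>S\<close> is exchanged with one derivative along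
  \<open>T\<close> at a time, until \<open>S\<close> is the direction applied first.\<close>

lemma iter_gateaux_move_last:
  assumes "smooth X"
  shows "iter_gateaux X (S # replicate k T) = iter_gateaux X (replicate k T @ [S])"
proof (induction k)
  case (Suc k)
  have "iter_gateaux X ([S, T] @ replicate k T) = iter_gateaux X ([T, S] @ replicate k T)"
    unfolding iter_gateaux_append
    by (rule ext, rule iter_gateaux_commute, rule smooth_iter_gateaux_fixed, rule assms)
  then show ?case using Suc.IH by simp
qed simp

section \<open>Iterated derivatives of affine substitutions, linear images and sums\<close>

lemma iter_gateaux_affine:
  assumes "linear L"
  shows "iter_gateaux (\<lambda>x. X (b + L x)) Ss = (\<lambda>x. iter_gateaux X (map L Ss) (b + L x))"
proof (induction Ss)
  case (Cons S Ss)
  then show ?case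
    by (simp add: gateaux_def linear_add[OF assms] linear_cmul[OF assms] add.assoc)
qed simp

lemma iter_gateaux_linear:
  assumes "smooth X" "linear L" "continuous_on UNIV L"
  shows "iter_gateaux (\<lambda>x. L (X x)) Ss = (\<lambda>x. L (iter_gateaux X Ss x))"
proof (induction Ss)
  case (Cons S Ss)
  have "gateaux (\<lambda>x. L (iter_gateaux X Ss x)) u S = L (gateaux (iter_gateaux X Ss) u S)" for u
    using continuous_on_UNIV_tendsto[OF assms(3) gateaux_tendsto[OF smooth_differentiable[OF assms(1), of Ss u S]]]
    by (intro gateauxI) (simp add: linear_cmul[OF assms(2)] linear_diff[OF assms(2)])
  then show ?case by (simp add: Cons.IH)
qed simp

lemma iter_gateaux_add:
  assumes "smooth X" "smooth Y"
  shows "iter_gateaux (\<lambda>x. X x + Y x) Ss = (\<lambda>x. iter_gateaux X Ss x + iter_gateaux Y Ss x)"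
  by (induction Ss) (simp_all add: gateaux_add smooth_differentiable assms)

lemma iter_gateaux_zero: "iter_gateaux (\<lambda>_::'a::lctvs. 0) Ss = (\<lambda>_. 0)"
  using iter_gateaux_linear[OF smooth_const, of "\<lambda>_. 0"] by (simp add: module_hom_zero)

lemma iter_gateaux_sum:
  assumes "\<And>i. i \<in> I \<Longrightarrow> smooth (X i)"
  shows "iter_gateaux (\<lambda>x. \<Sum>i\<in>I. X i x) Ss = (\<lambda>x. \<Sum>i\<in>I. iter_gateaux (X i) Ss x)"
  using assms
  by (induction I rule: infinite_finite_induct)
    (simp_all add: iter_gateaux_zero iter_gateaux_add smooth_sum)

lemma linear_gateaux: "smooth X \<Longrightarrow> linear (gateaux X u)"
  using linear_iter_gateaux_slot[of X "[]" "[]" u] by simp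

lemma gateaux_compose:
  assumes "smooth X" "gateaux_differentiable c u S"
  shows "gateaux (\<lambda>x. X (c x)) u S = gateaux X (c u) (gateaux c u S)"
  using iter_gateaux_difference_quotient[OF assms(1), of "\<lambda>\<epsilon>. c (u + \<epsilon> *\<^sub>R S)" "gateaux c u S" "[]" "[]"]
    gateaux_tendsto[OF assms(2)]
  by (intro gateauxI) simp

section \<open>Taylor coefficients of curves\<close>

definition taylor_coeff :: "nat \<Rightarrow> (real \<Rightarrow> 'b::lctvs) \<Rightarrow> 'b" where
  "taylor_coeff k c = (1 / fact k) *\<^sub>R curve_deriv k c 0"

lemma taylor_coeff_0 [simp]: "taylor_coeff 0 c = c 0"
  by (simp add: taylor_coeff_def curve_deriv_def)

text \<open>The coefficients of the derivative of a power series. This recursion allows coefficient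
  identities to be proved by differentiating once.\<close>

lemma taylor_coeff_Suc:
  "taylor_coeff k (\<lambda>\<epsilon>. gateaux c \<epsilon> 1) = real (Suc k) *\<^sub>R taylor_coeff (Suc k) c"
proof -
  have "iter_gateaux (\<lambda>\<epsilon>. gateaux c \<epsilon> 1) (replicate k 1) = iter_gateaux c (replicate (Suc k) 1)"
    using iter_gateaux_append[of c "replicate k 1" "[1]"] by (simp add: replicate_append_same)
  moreover have "real (Suc k) * (1 / fact (Suc k)) = 1 / fact k"
    by (simp add: divide_simps del: of_nat_Suc)
  ultimately show ?thesis
    by (simp only: taylor_coeff_def curve_deriv_def scaleR_scaleR)
qed

lemma taylor_coeff_linear:
  assumes "smooth c" "linear L" "continuous_on UNIV L"
  shows "taylor_coeff k (\<lambda>\<epsilon>. L (c \<epsilon>)) = L (taylor_coeff k c)"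
  by (simp add: taylor_coeff_def curve_deriv_def iter_gateaux_linear[OF assms] linear_cmul[OF assms(2)])

lemma taylor_coeff_scaleR: "smooth c \<Longrightarrow> taylor_coeff k (\<lambda>\<epsilon>. r *\<^sub>R c \<epsilon>) = r *\<^sub>R taylor_coeff k c"
  by (rule taylor_coeff_linear)
    (auto simp: linear_iff continuous_on_def scaleR_right_distrib intro: tendsto_scaleR_left_const)

lemma taylor_coeff_add:
  "smooth c \<Longrightarrow> smooth d \<Longrightarrow> taylor_coeff k (\<lambda>\<epsilon>. c \<epsilon> + d \<epsilon>) = taylor_coeff k c + taylor_coeff k d"
  by (simp add: taylor_coeff_def curve_deriv_def iter_gateaux_add scaleR_right_distrib)

lemma taylor_coeff_zero [simp]: "taylor_coeff k (\<lambda>\<epsilon>. 0) = 0"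
  by (simp add: taylor_coeff_def curve_deriv_def iter_gateaux_zero)

lemma taylor_coeff_sum:
  "(\<And>i. i \<in> I \<Longrightarrow> smooth (c i)) \<Longrightarrow>
    taylor_coeff k (\<lambda>\<epsilon>. \<Sum>i\<in>I. c i \<epsilon>) = (\<Sum>i\<in>I. taylor_coeff k (c i))"
  by (simp add: taylor_coeff_def curve_deriv_def iter_gateaux_sum scaleR_sum_right)

lemma gateaux_monomial:
  fixes v :: "'b::lctvs"
  shows "gateaux (\<lambda>\<epsilon>::real. \<epsilon> ^ m *\<^sub>R v) \<epsilon> 1 = (real m * \<epsilon> ^ (m - 1)) *\<^sub>R v"
proof (rule gateauxI)
  have "((\<lambda>h. (((\<epsilon> + h) ^ m - \<epsilon> ^ m) / h) *\<^sub>R v) \<longlongrightarrow> (real m * \<epsilon> ^ (m - 1)) *\<^sub>R v) (at 0)"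
    using DERIV_pow[of m \<epsilon> UNIV] by (intro tendsto_scaleR_lctvs tendsto_const) (simp add: DERIV_def)
  then show "((\<lambda>h::real. ((\<epsilon> + h *\<^sub>R 1) ^ m *\<^sub>R v - \<epsilon> ^ m *\<^sub>R v) /\<^sub>R h)
      \<longlongrightarrow> (real m * \<epsilon> ^ (m - 1)) *\<^sub>R v) (at 0)"
    by (simp add: scaleR_diff_left[symmetric] divide_inverse mult.commute)
qed

lemma smooth_monomial: "smooth (\<lambda>\<epsilon>::real. \<epsilon> ^ m *\<^sub>R v)"
  by (intro smooth_scaleR smooth_power smooth_ident smooth_const)

lemma taylor_coeff_monomial: "taylor_coeff k (\<lambda>\<epsilon>. \<epsilon> ^ m *\<^sub>R v) = (if k = m then v else 0)"
proof (induction k arbitrary: m)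
  case 0
  show ?case by simp
next
  case (Suc k)
  have "taylor_coeff k (\<lambda>\<epsilon>::real. (real m * \<epsilon> ^ (m - 1)) *\<^sub>R v) = real (Suc k) *\<^sub>R taylor_coeff (Suc k) (\<lambda>\<epsilon>. \<epsilon> ^ m *\<^sub>R v)"
    using taylor_coeff_Suc[of k "\<lambda>\<epsilon>. \<epsilon> ^ m *\<^sub>R v"] by (simp only: gateaux_monomial)
  moreover have "taylor_coeff k (\<lambda>\<epsilon>::real. (real m * \<epsilon> ^ (m - 1)) *\<^sub>R v) = real m *\<^sub>R (if k = m - 1 then v else 0)"
    using taylor_coeff_scaleR[OF smooth_monomial, of k "real m" "m - 1" v] by (simp add: Suc.IH)
  \<comment> \<open>For \<open>m = 0\<close> the truncated exponent \<open>m - 1\<close> is harmless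
    because of the factor \<open>real m\<close>; otherwise \<open>k = m - 1\<close> means
    \<open>Suc k = m\<close>.\<close>
  ultimately have "real (Suc k) *\<^sub>R taylor_coeff (Suc k) (\<lambda>\<epsilon>. \<epsilon> ^ m *\<^sub>R v) = real (Suc k) *\<^sub>R (if Suc k = m then v else 0)"
    by (cases m) auto
  then show ?case by (simp only: scaleR_cancel_left) simp
qed

section \<open>The Leibniz rule for Taylor coefficients\<close>

lemma gateaux_apply_curve:
  fixes M :: "real \<Rightarrow> 'a::lctvs \<Rightarrow> 'b::lctvs"
  assumes M: "smooth (\<lambda>(\<epsilon>, v). M \<epsilon> v)" "\<And>\<epsilon>. linear (M \<epsilon>)" and c: "smooth c"
  shows "gateaux (\<lambda>\<epsilon>. M \<epsilon> (c \<epsilon>)) \<epsilon> 1 = gateaux (\<lambda>e. M e (c \<epsilon>)) \<epsilon> 1 + M \<epsilon> (gateaux c \<epsilon> 1)"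
proof -
  let ?f = "\<lambda>(\<epsilon>, v). M \<epsilon> v"
  have Dc: "((\<lambda>h::real. (c (\<epsilon> + h *\<^sub>R 1) - c \<epsilon>) /\<^sub>R h) \<longlongrightarrow> gateaux c \<epsilon> 1) (at 0)"
    using gateaux_tendsto[OF smooth_differentiable[OF c, of "[]" \<epsilon> 1]] by simp
  have "((\<lambda>h::real. (\<epsilon> + h *\<^sub>R 1 - \<epsilon>) /\<^sub>R h) \<longlongrightarrow> 1) (at 0)"
    by (rule tendsto_eventually) (simp add: eventually_at_filter)
  from tendsto_Pair[OF this Dc]
  have P: "((\<lambda>h::real. ((\<epsilon> + h *\<^sub>R 1, c (\<epsilon> + h *\<^sub>R 1)) - (\<epsilon>, c \<epsilon>)) /\<^sub>R h) \<longlongrightarrow> (1, gateaux c \<epsilon> 1)) (at 0)"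
    by simp
  then have "gateaux_differentiable (\<lambda>\<epsilon>. (\<epsilon>, c \<epsilon>)) \<epsilon> 1"
    by (auto simp: gateaux_differentiable_def)
  from gateaux_compose[OF M(1) this]
  have "gateaux (\<lambda>\<epsilon>. M \<epsilon> (c \<epsilon>)) \<epsilon> 1 = gateaux ?f (\<epsilon>, c \<epsilon>) (1, gateaux c \<epsilon> 1)"
    by (simp add: gateauxI[OF P])
  \<comment> \<open>The direction is split into the two partial directions: the first differentiates
    the operator at a fixed vector, the second the curve under a fixed linear map.\<close>
  also have "\<dots> = gateaux ?f (\<epsilon>, c \<epsilon>) ((1, 0) + (0, gateaux c \<epsilon> 1))"
    by simp
  also have "\<dots> = gateaux ?f (\<epsilon>, c \<epsilon>) (1, 0) + gateaux ?f (\<epsilon>, c \<epsilon>) (0, gateaux c \<epsilon> 1)"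
    by (rule linear_add[OF linear_gateaux[OF M(1)]])
  also have "gateaux ?f (\<epsilon>, c \<epsilon>) (1, 0) = gateaux (\<lambda>e. M e (c \<epsilon>)) \<epsilon> 1"
    by (simp add: gateaux_def)
  also have "gateaux ?f (\<epsilon>, c \<epsilon>) (0, gateaux c \<epsilon> 1) = M \<epsilon> (gateaux c \<epsilon> 1)"
    by (rule gateauxI, rule tendsto_eventually)
      (simp add: eventually_at_filter linear_add[OF M(2)] linear_cmul[OF M(2)])
  finally show ?thesis by simp
qed

text \<open>A product rule in which the moving vector is replaced by its constant Taylor
  coefficients. After one differentiation the induction hypothesis applies both to the derivative of
  \<open>M\<close> with \<open>c\<close> and to \<open>M\<close> with the derivative of
  \<open>c\<close>. The resulting weights \<open>Suc p - q\<close> and \<open>q\<close> add up to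
  \<open>Suc p\<close>.\<close>

lemma taylor_coeff_Leibniz:
  fixes M :: "real \<Rightarrow> 'a::lctvs \<Rightarrow> 'b::lctvs"
  assumes "smooth (\<lambda>(\<epsilon>, v). M \<epsilon> v)" "\<And>\<epsilon>. linear (M \<epsilon>)" "smooth c"
  shows "taylor_coeff p (\<lambda>\<epsilon>. M \<epsilon> (c \<epsilon>)) = (\<Sum>q\<le>p. taylor_coeff (p - q) (\<lambda>\<epsilon>. M \<epsilon> (taylor_coeff q c)))"
  using assms
proof (induction p arbitrary: M c)
  case 0
  show ?case by simp
next
  case (Suc p)
  note M = Suc.prems(1,2) and c = Suc.prems(3)
  define M' where "M' = (\<lambda>\<epsilon> v. gateaux (\<lambda>e. M e v) \<epsilon> 1)"
  define c' where "c' = (\<lambda>\<epsilon>. gateaux c \<epsilon> 1)"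
  define t where "t = (\<lambda>r q. taylor_coeff r (\<lambda>\<epsilon>. M \<epsilon> (taylor_coeff q c)))"
  have sM: "smooth (\<lambda>\<epsilon>. M \<epsilon> (d \<epsilon>))" if "smooth d" for d
    using smooth_compose[OF M(1) smooth_Pair[OF smooth_ident that]] by simp
  have "M' \<epsilon> v = gateaux (\<lambda>(\<epsilon>, v). M \<epsilon> v) (\<epsilon>, v) (1, 0)" for \<epsilon> v
    by (simp add: M'_def gateaux_def)
  then have M'1: "smooth (\<lambda>(\<epsilon>, v). M' \<epsilon> v)"
    using smooth_gateaux[OF M(1) smooth_ident smooth_const] by (simp add: case_prod_unfold)
  have diff: "gateaux_differentiable (\<lambda>e. M e v) \<epsilon> 1" for v \<epsilon>
    using smooth_differentiable[OF sM[OF smooth_const], of _ "[]"] by simp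
  have M'2: "linear (M' \<epsilon>)" for \<epsilon>
    unfolding M'_def
    by (rule linearI) (simp_all add: linear_add[OF M(2)] linear_cmul[OF M(2)] gateaux_add gateaux_scaleR diff)
  have c': "smooth c'"
    unfolding c'_def by (rule smooth_gateaux[OF c smooth_ident smooth_const])
  have sM': "smooth (\<lambda>\<epsilon>. M' \<epsilon> (c \<epsilon>))"
    using smooth_compose[OF M'1 smooth_Pair[OF smooth_ident c]] by simp
  have 1: "taylor_coeff (p - q) (\<lambda>\<epsilon>. M' \<epsilon> (taylor_coeff q c)) = real (Suc (p - q)) *\<^sub>R t (Suc (p - q)) q" for q
    unfolding M'_def t_def by (rule taylor_coeff_Suc)
  have 2: "taylor_coeff (p - q) (\<lambda>\<epsilon>. M \<epsilon> (taylor_coeff q c')) = real (Suc q) *\<^sub>R t (p - q) (Suc q)" for q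
    unfolding c'_def t_def taylor_coeff_Suc linear_cmul[OF M(2)]
    by (rule taylor_coeff_scaleR[OF sM[OF smooth_const]])
  have "real (Suc p) *\<^sub>R taylor_coeff (Suc p) (\<lambda>\<epsilon>. M \<epsilon> (c \<epsilon>)) =
      taylor_coeff p (\<lambda>\<epsilon>. M' \<epsilon> (c \<epsilon>) + M \<epsilon> (c' \<epsilon>))"
    unfolding taylor_coeff_Suc[symmetric] gateaux_apply_curve[OF M c] M'_def c'_def ..
  also have "\<dots> = (\<Sum>q\<le>p. real (Suc (p - q)) *\<^sub>R t (Suc (p - q)) q) + (\<Sum>q\<le>p. real (Suc q) *\<^sub>R t (p - q) (Suc q))"
    unfolding taylor_coeff_add[OF sM' sM[OF c']] Suc.IH[OF M'1 M'2 c] Suc.IH[OF M c'] 1 2 ..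
  \<comment> \<open>Both sums are brought to the range up to \<open>Suc p\<close>: here the added
    last term has weight zero, and in the next sum the index is shifted and the new first term has
    weight zero.\<close>
  also have "(\<Sum>q\<le>p. real (Suc (p - q)) *\<^sub>R t (Suc (p - q)) q) = (\<Sum>q\<le>Suc p. real (Suc p - q) *\<^sub>R t (Suc p - q) q)"
    by (simp add: of_nat_diff Suc_diff_le add_diff_eq)
  also have "(\<Sum>q\<le>p. real (Suc q) *\<^sub>R t (p - q) (Suc q)) = (\<Sum>q\<le>Suc p. real q *\<^sub>R t (Suc p - q) q)"
    by (subst sum.atMost_Suc_shift) simp
  also have "(\<Sum>q\<le>Suc p. real (Suc p - q) *\<^sub>R t (Suc p - q) q) + (\<Sum>q\<le>Suc p. real q *\<^sub>R t (Suc p - q) q) =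
      real (Suc p) *\<^sub>R (\<Sum>q\<le>Suc p. t (Suc p - q) q)"
    unfolding sum.distrib[symmetric] scaleR_sum_right scaleR_left_distrib[symmetric]
    by (intro sum.cong refl arg_cong2[where f = scaleR]) auto
  finally show ?case
    unfolding t_def by (simp only: scaleR_cancel_left) simp
qed

section \<open>Taylor coefficients depending on a parameter\<close>

lemma taylor_coeff_param_eq:
  fixes \<Phi> :: "'a::lctvs \<Rightarrow> real \<Rightarrow> 'b::lctvs"
  shows "taylor_coeff k (\<Phi> x) = (1 / fact k) *\<^sub>R iter_gateaux (\<lambda>(x, \<epsilon>). \<Phi> x \<epsilon>) (replicate k (0, 1)) (x, 0)"
proof -
  have "linear (\<lambda>\<epsilon>::real. (0::'a, \<epsilon>))" by (rule linearI) simp_all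
  from iter_gateaux_affine[OF this, of "\<lambda>(x, \<epsilon>). \<Phi> x \<epsilon>" "(x, 0)" "replicate k 1"]
  show ?thesis by (simp add: taylor_coeff_def curve_deriv_def fun_eq_iff)
qed

lemma smooth_taylor_coeff:
  assumes "smooth (\<lambda>(x, \<epsilon>). \<Phi> x \<epsilon>)"
  shows "smooth (\<lambda>x. taylor_coeff k (\<Phi> x))"
proof -
  have "smooth (\<lambda>x. (1 / fact k) *\<^sub>R iter_gateaux (\<lambda>(x, \<epsilon>). \<Phi> x \<epsilon>)
      (map (\<lambda>h. h x) (replicate k (\<lambda>_. (0, 1)))) (x, 0))"
    by (intro smooth_scaleR smooth_const smooth_iter_gateaux assms smooth_Pair smooth_ident)
      (auto simp: smooth_const)
  then show ?thesis by (simp add: taylor_coeff_param_eq)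
qed

text \<open>On the product space the Taylor coefficient consists of \<open>k\<close> derivatives
  along \<open>(0, 1)\<close>, and the derivative in the parameter is one along
  \<open>(S, 0)\<close>. Symmetry of mixed derivatives lets the latter be taken first.\<close>

lemma gateaux_taylor_coeff:
  assumes \<Phi>: "smooth (\<lambda>(x, \<epsilon>). \<Phi> x \<epsilon>)"
  shows "gateaux (\<lambda>x. taylor_coeff k (\<Phi> x)) x S = taylor_coeff k (\<lambda>\<epsilon>. gateaux (\<lambda>x. \<Phi> x \<epsilon>) x S)"
proof -
  let ?\<Phi> = "\<lambda>(x, \<epsilon>). \<Phi> x \<epsilon>" and ?r = "replicate k (0, 1)"
  have "gateaux_differentiable (\<lambda>x. iter_gateaux ?\<Phi> ?r (x, 0)) x S"
    using smooth_differentiable[OF smooth_compose[OF smooth_iter_gateaux_fixed[OF \<Phi>]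
        smooth_Pair[OF smooth_ident smooth_const]], of _ _ "[]"] by simp
  then have "gateaux (\<lambda>x. taylor_coeff k (\<Phi> x)) x S =
      (1 / fact k) *\<^sub>R gateaux (\<lambda>x. iter_gateaux ?\<Phi> ?r (x, 0)) x S"
    unfolding taylor_coeff_param_eq by (rule gateaux_scaleR)
  also have "gateaux (\<lambda>x. iter_gateaux ?\<Phi> ?r (x, 0)) x S = iter_gateaux ?\<Phi> ((S, 0) # ?r) (x, 0)"
    by (simp add: gateaux_def)
  also have "\<dots> = iter_gateaux (\<lambda>(x, \<epsilon>). gateaux (\<lambda>x. \<Phi> x \<epsilon>) x S) ?r (x, 0)"
    unfolding iter_gateaux_move_last[OF \<Phi>] iter_gateaux_append
    by (simp add: gateaux_def case_prod_unfold)
  finally show ?thesis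
    by (simp add: taylor_coeff_param_eq[of k "\<lambda>x \<epsilon>. gateaux (\<lambda>x. \<Phi> x \<epsilon>) x S"])
qed

section \<open>The perturbed operator\<close>

lemma u_hat_add_scaleR: "u_hat idx (\<eta> + r *\<^sub>R S) \<epsilon> = u_hat idx \<eta> \<epsilon> + r *\<^sub>R u_hat idx S \<epsilon>"
  by (simp add: u_hat_def sum.distrib scaleR_sum_right scaleR_right_distrib mult.commute)

lemma smooth_u_hat:
  assumes "smooth f" "smooth e"
  shows "smooth (\<lambda>x. u_hat idx (f x) (e x))"
  unfolding u_hat_def by (intro smooth_sum smooth_scaleR smooth_power smooth_vec_nth assms)

lemma taylor_coeff_u_hat:
  assumes "inj idx"
  shows "taylor_coeff (idx i) (u_hat idx \<eta>) = \<eta> $ i"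
proof -
  have "taylor_coeff (idx i) (u_hat idx \<eta>) = (\<Sum>j\<in>UNIV. if idx i = idx j then \<eta> $ j else 0)"
    unfolding u_hat_def[abs_def] by (subst taylor_coeff_sum) (simp_all add: smooth_monomial taylor_coeff_monomial)
  then show ?thesis by (simp add: inj_eq[OF assms])
qed

lemma J_hat_block_eq:
  "J_hat_block N idx J \<eta> i j \<gamma> =
    (if i + j < N then 0 else taylor_coeff (i + j - N) (\<lambda>\<epsilon>. J (u_hat idx \<eta> \<epsilon>) \<gamma>))"
  by (simp add: J_hat_block_def taylor_coeff_def)

section \<open>Smoothness and derivative of the perturbed operator\<close>

context
  fixes J :: "'e::lctvs \<Rightarrow> 'f::lctvs \<Rightarrow> 'e"
  assumes op: "linear_operator J"
begin

lemma linear_J: "linear (J u)"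
  using op by (simp add: linear_operator_def)

lemma smooth_uncurried_J: "smooth (\<lambda>(u, \<gamma>). J u \<gamma>)"
  using op by (simp add: linear_operator_def)

lemma smooth_J: "smooth f \<Longrightarrow> smooth g \<Longrightarrow> smooth (\<lambda>x. J (f x) (g x))"
  using smooth_compose[OF smooth_uncurried_J smooth_Pair] by fastforce

text \<open>As a partial derivative of the uncurried operator, \<open>op_deriv J\<close> inherits
  joint smoothness in the point, the direction and the covector.\<close>

lemma op_deriv_eq: "op_deriv J u S \<gamma> = gateaux (\<lambda>(u, \<gamma>). J u \<gamma>) (u, \<gamma>) (S, 0)"
  by (simp add: op_deriv_def gateaux_def)

lemma smooth_op_deriv:
  assumes "smooth f" "smooth g" "smooth h"
  shows "smooth (\<lambda>x. op_deriv J (f x) (g x) (h x))"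
  unfolding op_deriv_eq by (intro smooth_gateaux smooth_uncurried_J smooth_Pair smooth_const assms)

lemma linear_op_deriv: "linear (\<lambda>S. op_deriv J u S \<gamma>)"
proof -
  have "linear (gateaux (\<lambda>v. J v \<gamma>) u)"
    by (intro linear_gateaux smooth_J smooth_ident smooth_const)
  then show ?thesis by (simp add: op_deriv_def)
qed

lemma smooth_J_u_hat_block:
  "smooth (\<lambda>(\<eta>, \<epsilon>). J (u_hat idx \<eta> \<epsilon>) \<gamma>)"
  unfolding case_prod_unfold
  by (intro smooth_J smooth_u_hat smooth_fst smooth_snd smooth_ident smooth_const)

lemma linear_operator_J_hat:
  fixes idx :: "'n::finite \<Rightarrow> nat"
  shows "linear_operator (J_hat N idx J)"
  unfolding linear_operator_def
proof
  have J_curve: "smooth (\<lambda>\<epsilon>. J (u_hat idx \<eta> \<epsilon>) \<gamma>)" for \<eta> \<gamma>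
    by (intro smooth_J smooth_u_hat smooth_ident smooth_const)
  have add: "J_hat_block N idx J \<eta> i j (\<gamma> + \<delta>) = J_hat_block N idx J \<eta> i j \<gamma> + J_hat_block N idx J \<eta> i j \<delta>"
    for \<eta> i j \<gamma> \<delta>
    by (simp add: J_hat_block_eq linear_add[OF linear_J] taylor_coeff_add J_curve)
  have scale: "J_hat_block N idx J \<eta> i j (r *\<^sub>R \<gamma>) = r *\<^sub>R J_hat_block N idx J \<eta> i j \<gamma>" for \<eta> i j \<gamma> r
    by (simp add: J_hat_block_eq linear_cmul[OF linear_J] taylor_coeff_scaleR J_curve)
  show "\<forall>u. linear (J_hat N idx J u)"
    by (auto intro!: linearI simp: J_hat_def vec_eq_iff add scale sum.distrib scaleR_sum_right)
  have "smooth (\<lambda>x. J_hat_block N idx J (fst x) i k (snd x $ j))" for i k and j :: 'n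
  proof (cases "i + k < N")
    case False
    have "smooth (\<lambda>(x, \<epsilon>). J (u_hat idx (fst x) \<epsilon>) (snd x $ j))"
      unfolding case_prod_unfold
      by (intro smooth_J smooth_u_hat smooth_vec_nth smooth_fst smooth_snd smooth_ident)
    from smooth_taylor_coeff[OF this] False show ?thesis
      by (simp add: J_hat_block_eq)
  qed (simp add: J_hat_block_eq smooth_const)
  then show "smooth (\<lambda>(u, \<gamma>). J_hat N idx J u \<gamma>)"
    unfolding J_hat_def case_prod_unfold by (intro smooth_vec_lambda smooth_sum)
qed

text \<open>The curve \<open>u_hat\<close> is linear in the tuple, so its derivative along
  \<open>S\<close> is \<open>u_hat idx S\<close>. The parameter derivative is then moved inside each
  Taylor coefficient.\<close>

lemma op_deriv_J_hat:
  fixes idx :: "'n::finite \<Rightarrow> nat"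
  shows "op_deriv (J_hat N idx J) \<eta> S \<gamma> $ i = (\<Sum>l\<in>UNIV. if idx i + idx l < N then 0
    else taylor_coeff (idx i + idx l - N) (\<lambda>\<epsilon>. op_deriv J (u_hat idx \<eta> \<epsilon>) (u_hat idx S \<epsilon>) (\<gamma> $ l)))"
proof -
  have s: "smooth (\<lambda>\<eta>. J_hat_block N idx J \<eta> (idx i) (idx l) (\<gamma> $ l))" for i l
    by (cases "idx i + idx l < N")
      (simp_all add: J_hat_block_eq smooth_const smooth_taylor_coeff smooth_J_u_hat_block)
  have sh: "smooth (\<lambda>\<eta>. J_hat N idx J \<eta> \<gamma>)"
    unfolding J_hat_def by (intro smooth_vec_lambda smooth_sum s)
  have "linear (\<lambda>x. x $ i)" "continuous_on UNIV (\<lambda>x::'e ^ 'n. x $ i)"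
    by (simp_all add: linear_iff continuous_on_def tendsto_vec_nth)
  from iter_gateaux_linear[OF sh this, of "[S]"]
  have "op_deriv (J_hat N idx J) \<eta> S \<gamma> $ i = gateaux (\<lambda>\<eta>. J_hat N idx J \<eta> \<gamma> $ i) \<eta> S"
    by (simp add: op_deriv_def fun_eq_iff)
  also have "\<dots> = (\<Sum>l\<in>UNIV. gateaux (\<lambda>\<eta>. J_hat_block N idx J \<eta> (idx i) (idx l) (\<gamma> $ l)) \<eta> S)"
    using iter_gateaux_sum[of UNIV "\<lambda>l \<eta>. J_hat_block N idx J \<eta> (idx i) (idx l) (\<gamma> $ l)" "[S]"] s
    by (simp add: J_hat_def fun_eq_iff)
  finally have components: "op_deriv (J_hat N idx J) \<eta> S \<gamma> $ i =
      (\<Sum>l\<in>UNIV. gateaux (\<lambda>\<eta>. J_hat_block N idx J \<eta> (idx i) (idx l) (\<gamma> $ l)) \<eta> S)" .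
  have "gateaux (\<lambda>\<eta>. J_hat_block N idx J \<eta> (idx i) (idx l) (\<gamma> $ l)) \<eta> S =
      (if idx i + idx l < N then 0 else taylor_coeff (idx i + idx l - N)
        (\<lambda>\<epsilon>. op_deriv J (u_hat idx \<eta> \<epsilon>) (u_hat idx S \<epsilon>) (\<gamma> $ l)))" for l
  proof -
    have "gateaux (\<lambda>\<eta>. J (u_hat idx \<eta> \<epsilon>) (\<gamma> $ l)) \<eta> S =
        op_deriv J (u_hat idx \<eta> \<epsilon>) (u_hat idx S \<epsilon>) (\<gamma> $ l)" for \<epsilon>
      by (simp add: gateaux_def op_deriv_def u_hat_add_scaleR)
    moreover have "gateaux (\<lambda>_. 0) \<eta> S = (0::'e)"
      by (rule gateauxI) simp
    ultimately show ?thesis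
      by (simp add: J_hat_block_eq gateaux_taylor_coeff[OF smooth_J_u_hat_block])
  qed
  then show ?thesis by (simp only: components)
qed

end

section \<open>Pairings of the perturbed operator as Taylor coefficients along the curve\<close>

context
  fixes pair :: "'f::lctvs \<Rightarrow> 'e::lctvs \<Rightarrow> real"
    and J :: "'e \<Rightarrow> 'f \<Rightarrow> 'e"
    and N :: nat
    and idx :: "'n::finite \<Rightarrow> nat"
  assumes pairing: "duality_pairing pair"
    and op: "linear_operator J"
    and idx: "bij_betw idx (UNIV :: 'n set) {0..N}"
begin

lemma pair_linear: "linear (pair a)"
  using pairing by (simp add: duality_pairing_def)

lemma pair_continuous: "continuous_on UNIV (pair a)"
  using pairing by (simp add: duality_pairing_def)

lemma taylor_coeff_pair: "smooth c \<Longrightarrow> taylor_coeff k (\<lambda>\<epsilon>. pair a (c \<epsilon>)) = pair a (taylor_coeff k c)"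
  by (rule taylor_coeff_linear[OF _ pair_linear pair_continuous])

lemma idx_le: "idx i \<le> N"
  using idx by (auto simp: bij_betw_def)

lemma smooth_J_curve: "smooth (\<lambda>\<epsilon>. J (u_hat idx \<eta> \<epsilon>) \<gamma>)"
  by (intro smooth_J[OF op] smooth_u_hat smooth_ident smooth_const)

lemma taylor_coeff_u_hat_J_hat:
  assumes "q \<le> N"
  shows "taylor_coeff q (u_hat idx (J_hat N idx J \<eta> \<beta>)) =
    (\<Sum>j\<in>UNIV. if q + idx j < N then 0 else taylor_coeff (q + idx j - N) (\<lambda>\<epsilon>. J (u_hat idx \<eta> \<epsilon>) (\<beta> $ j)))"
proof -
  obtain i where i: "q = idx i"
    using assms idx unfolding bij_betw_def by (metis atLeastAtMost_iff imageE le0)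
  have "inj idx" using idx by (simp add: bij_betw_def)
  then show ?thesis
    unfolding i by (simp add: taylor_coeff_u_hat J_hat_def J_hat_block_eq)
qed

text \<open>Pairing with a fixed covector is continuous and linear, so it commutes with Taylor
  coefficients. The order \<open>idx i + idx j - N\<close> arises as the coefficient of
  \<open>\<epsilon>^N\<close> after multiplication by \<open>\<epsilon>^(N - idx i)\<close> and
  \<open>\<epsilon>^(N - idx j)\<close>.\<close>

lemma hat_pair_J_hat:
  "hat_pair pair \<alpha> (J_hat N idx J \<eta> \<beta>) = (\<Sum>i\<in>UNIV. \<Sum>j\<in>UNIV. if idx i + idx j < N then 0
    else taylor_coeff (idx i + idx j - N) (\<lambda>\<epsilon>. pair (\<alpha> $ i) (J (u_hat idx \<eta> \<epsilon>) (\<beta> $ j))))"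
  unfolding hat_pair_def J_hat_def J_hat_block_eq
  by (auto simp: linear_sum[OF pair_linear] linear_0[OF pair_linear] taylor_coeff_pair[OF smooth_J_curve]
      intro!: sum.cong)

text \<open>The tuple \<open>J_hat \<beta>\<close> lists the first \<open>N + 1\<close> Taylor coefficients of the curve
  \<open>\<Sum>\<^sub>j \<epsilon>\<^sup>N\<^sup>-\<^sup>j J(u_hat) \<beta>\<^sub>j\<close>, so the Leibniz rule is applied once to the tuple and once, backwards, to
  each \<open>J(u_hat) \<beta>\<^sub>j\<close>.\<close>

lemma taylor_coeff_J_hat_direction:
  assumes k: "k \<le> N"
  shows "taylor_coeff k (\<lambda>\<epsilon>. pair a (op_deriv J (u_hat idx \<eta> \<epsilon>) (u_hat idx (J_hat N idx J \<eta> \<beta>) \<epsilon>) c)) =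
    (\<Sum>j\<in>UNIV. if k + idx j < N then 0 else taylor_coeff (k + idx j - N)
      (\<lambda>\<epsilon>. pair a (op_deriv J (u_hat idx \<eta> \<epsilon>) (J (u_hat idx \<eta> \<epsilon>) (\<beta> $ j)) c)))"
proof -
  define M where "M = (\<lambda>\<epsilon> v. pair a (op_deriv J (u_hat idx \<eta> \<epsilon>) v c))"
  define d where "d = (\<lambda>j \<epsilon>. J (u_hat idx \<eta> \<epsilon>) (\<beta> $ j))"
  have M1: "smooth (\<lambda>(\<epsilon>, v). M \<epsilon> v)"
    unfolding M_def case_prod_unfold
    by (intro smooth_linear_compose[OF pair_linear pair_continuous] smooth_op_deriv[OF op]
        smooth_u_hat smooth_fst smooth_snd smooth_ident smooth_const)
  have M2: "linear (M \<epsilon>)" for \<epsilon>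
    using linear_compose[OF linear_op_deriv[OF op] pair_linear] by (simp add: M_def comp_def)
  have Mc: "smooth (\<lambda>\<epsilon>. M \<epsilon> v)" for v
    using smooth_compose[OF M1 smooth_Pair[OF smooth_ident smooth_const]] by simp
  have d: "smooth (d j)" for j
    unfolding d_def by (rule smooth_J_curve)
  let ?m = "\<lambda>k q v. taylor_coeff (k - q) (\<lambda>\<epsilon>. M \<epsilon> v)"
  have "taylor_coeff k (\<lambda>\<epsilon>. M \<epsilon> (u_hat idx (J_hat N idx J \<eta> \<beta>) \<epsilon>)) =
      (\<Sum>q\<le>k. ?m k q (taylor_coeff q (u_hat idx (J_hat N idx J \<eta> \<beta>))))"
    by (intro taylor_coeff_Leibniz M1 M2 smooth_u_hat smooth_const smooth_ident)
  also have "\<dots> = (\<Sum>q\<le>k. \<Sum>j\<in>UNIV. if q + idx j < N then 0 else ?m k q (taylor_coeff (q + idx j - N) (d j)))"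
  proof (rule sum.cong[OF refl])
    fix q assume "q \<in> {..k}"
    then have "q \<le> N" using k by simp
    have "?m k q (\<Sum>j\<in>UNIV. w j) = (\<Sum>j\<in>UNIV. ?m k q (w j))" for w :: "'n \<Rightarrow> 'e"
      by (simp add: linear_sum[OF M2] taylor_coeff_sum Mc)
    moreover have "?m k q (if b then 0 else v) = (if b then 0 else ?m k q v)" for b v
      by (simp add: linear_0[OF M2])
    ultimately show "?m k q (taylor_coeff q (u_hat idx (J_hat N idx J \<eta> \<beta>))) =
        (\<Sum>j\<in>UNIV. if q + idx j < N then 0 else ?m k q (taylor_coeff (q + idx j - N) (d j)))"
      unfolding taylor_coeff_u_hat_J_hat[OF \<open>q \<le> N\<close>] d_def by (simp only:)
  qed
  also have "\<dots> = (\<Sum>j\<in>UNIV. \<Sum>q\<le>k. if q + idx j < N then 0 else ?m k q (taylor_coeff (q + idx j - N) (d j)))"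
    by (rule sum.swap)
  also have "\<dots> = (\<Sum>j\<in>UNIV. if k + idx j < N then 0 else taylor_coeff (k + idx j - N) (\<lambda>\<epsilon>. M \<epsilon> (d j \<epsilon>)))"
  proof (rule sum.cong[OF refl])
    fix j
    let ?p = "k + idx j - N"
    show "(\<Sum>q\<le>k. if q + idx j < N then 0 else ?m k q (taylor_coeff (q + idx j - N) (d j))) =
        (if k + idx j < N then 0 else taylor_coeff ?p (\<lambda>\<epsilon>. M \<epsilon> (d j \<epsilon>)))"
    proof (cases "k + idx j < N")
      case False
      have "(\<Sum>q\<le>k. if q + idx j < N then 0 else ?m k q (taylor_coeff (q + idx j - N) (d j))) =
          (\<Sum>q\<in>{N - idx j..k}. ?m k q (taylor_coeff (q + idx j - N) (d j)))"
        by (rule sum.mono_neutral_cong_right) auto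
      \<comment> \<open>Substituting \<open>r = q + idx j - N\<close> maps the surviving range onto
        \<open>{..?p}\<close>, where \<open>idx j \<le> N\<close> makes \<open>N - idx j\<close> a
        genuine shift. Then \<open>k - q = ?p - r\<close>, which is exactly the Leibniz sum for
        \<open>M\<close> applied to \<open>d j\<close>.\<close>
      also have "\<dots> = (\<Sum>r\<le>?p. ?m ?p r (taylor_coeff r (d j)))"
        using False idx_le[of j]
        by (intro sum.reindex_bij_witness[where i = "\<lambda>r. r + (N - idx j)" and j = "\<lambda>q. q + idx j - N"])
          (auto intro!: arg_cong2[where f = taylor_coeff])
      also have "\<dots> = taylor_coeff ?p (\<lambda>\<epsilon>. M \<epsilon> (d j \<epsilon>))"
        by (rule taylor_coeff_Leibniz[symmetric, OF M1 M2 d])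
      finally show ?thesis using False by simp
    qed (auto intro!: sum.neutral)
  qed
  finally show ?thesis by (simp only: M_def d_def)
qed

text \<open>Three covectors in reversed numbering carry the power
  \<open>\<epsilon>^(3 * N - m)\<close>, where \<open>m\<close> is the sum of their indices. The
  coefficient of \<open>\<epsilon>^N\<close> in the product is therefore the coefficient of order
  \<open>m - 2 * N\<close> of the remaining factor.\<close>

definition jacobi_term :: "'e ^ 'n \<Rightarrow> 'f \<Rightarrow> 'f \<Rightarrow> 'f \<Rightarrow> nat \<Rightarrow> real" where
  "jacobi_term \<eta> a b c m = (if m < 2 * N then 0 else taylor_coeff (m - 2 * N)
    (\<lambda>\<epsilon>. pair a (op_deriv J (u_hat idx \<eta> \<epsilon>) (J (u_hat idx \<eta> \<epsilon>) b) c)))"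

text \<open>Two successive index shifts by \<open>N\<close>, one from the outer operator and one
  from the direction, combine into a shift by \<open>2 * N\<close>. If the outer block vanishes,
  then \<open>idx j \<le> N\<close> keeps the total index below \<open>2 * N\<close>, so both sides
  are zero.\<close>

lemma hat_pair_op_deriv_J_hat:
  "hat_pair pair \<alpha> (op_deriv (J_hat N idx J) \<eta> (J_hat N idx J \<eta> \<beta>) \<gamma>) =
    (\<Sum>i\<in>UNIV. \<Sum>l\<in>UNIV. \<Sum>j\<in>UNIV. jacobi_term \<eta> (\<alpha> $ i) (\<beta> $ j) (\<gamma> $ l) (idx i + idx l + idx j))"
proof -
  let ?S = "J_hat N idx J \<eta> \<beta>"
  have "pair (\<alpha> $ i) (if idx i + idx l < N then 0 else taylor_coeff (idx i + idx l - N)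
        (\<lambda>\<epsilon>. op_deriv J (u_hat idx \<eta> \<epsilon>) (u_hat idx ?S \<epsilon>) (\<gamma> $ l))) =
      (\<Sum>j\<in>UNIV. jacobi_term \<eta> (\<alpha> $ i) (\<beta> $ j) (\<gamma> $ l) (idx i + idx l + idx j))" for i l
  proof (cases "idx i + idx l < N")
    case True
    have "idx i + idx l + idx j < 2 * N" for j
      using True idx_le[of j] by simp
    then show ?thesis using True by (simp add: jacobi_term_def linear_0[OF pair_linear])
  next
    case False
    have "smooth (\<lambda>\<epsilon>. op_deriv J (u_hat idx \<eta> \<epsilon>) (u_hat idx ?S \<epsilon>) (\<gamma> $ l))"
      by (intro smooth_op_deriv[OF op] smooth_u_hat smooth_ident smooth_const)
    moreover have "idx i + idx l - N \<le> N"
      using idx_le[of i] idx_le[of l] by simp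
    moreover have "idx i + idx l - N + idx j < N \<longleftrightarrow> idx i + idx l + idx j < 2 * N"
      "idx i + idx l - N + idx j - N = idx i + idx l + idx j - 2 * N" for j
      using False by auto
    ultimately show ?thesis
      using False
      by (simp add: taylor_coeff_pair[symmetric] taylor_coeff_J_hat_direction jacobi_term_def
          cong: if_cong del: Nat.add_diff_assoc2 diff_diff_left)
  qed
  then show ?thesis
    by (simp add: hat_pair_def op_deriv_J_hat[OF op] linear_sum[OF pair_linear])
qed

text \<open>The Jacobi identity holds at every point of the curve \<open>u_hat idx \<eta>\<close>,
  so each Taylor coefficient of the cyclic sum vanishes.\<close>

lemma jacobi_term_cycle:
  assumes "\<And>u. pair a (op_deriv J u (J u b) c) + pair b (op_deriv J u (J u c) a) +
    pair c (op_deriv J u (J u a) b) = 0"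
  shows "jacobi_term \<eta> a b c m + jacobi_term \<eta> b c a m + jacobi_term \<eta> c a b m = 0"
proof -
  have s: "smooth (\<lambda>\<epsilon>. pair a (op_deriv J (u_hat idx \<eta> \<epsilon>) (J (u_hat idx \<eta> \<epsilon>) b) c))" for a b c
    by (intro smooth_linear_compose[OF pair_linear pair_continuous] smooth_op_deriv[OF op]
        smooth_J_curve smooth_u_hat smooth_ident smooth_const)
  have s2: "smooth (\<lambda>\<epsilon>. pair a (op_deriv J (u_hat idx \<eta> \<epsilon>) (J (u_hat idx \<eta> \<epsilon>) b) c) +
      pair b (op_deriv J (u_hat idx \<eta> \<epsilon>) (J (u_hat idx \<eta> \<epsilon>) c) a))"
    by (intro smooth_add s)
  show ?thesis
    using assms unfolding jacobi_term_def
    by (simp add: taylor_coeff_add[OF s s, symmetric] taylor_coeff_add[OF s2 s, symmetric])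
qed

end

theorem theorem2p2:
  fixes pair :: "'f::lctvs \<Rightarrow> 'e::lctvs \<Rightarrow> real"
    and J :: "'e \<Rightarrow> 'f \<Rightarrow> 'e"
    and N :: nat
    and idx :: "'n::finite \<Rightarrow> nat"
  assumes "duality_pairing pair"
    and "N \<ge> 1"
    and "bij_betw idx (UNIV :: 'n set) {0..N}"
    and "hamiltonian pair J"
  shows "hamiltonian (hat_pair pair) (J_hat N idx J)"
proof -
  have op: "linear_operator J" using assms(4) by (simp add: hamiltonian_def)
  \<comment> \<open>Every covector is the value of a constant field, so the two identities for
    fields become identities for covectors at each point.\<close>
  have const: "(\<lambda>_::'e. a) \<in> cotangent_fields" for a :: 'f
    by (simp add: cotangent_fields_def smooth_const)
  have skew: "pair a (J u b) = - pair b (J u a)" for a b u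
  proof -
    have "\<forall>\<alpha>\<in>cotangent_fields. \<forall>\<beta>\<in>cotangent_fields. \<forall>u. pair (\<alpha> u) (J u (\<beta> u)) = - pair (\<beta> u) (J u (\<alpha> u))"
      using assms(4) unfolding hamiltonian_def by blast
    from bspec[OF bspec[OF this const[of a]] const[of b]] show ?thesis by blast
  qed
  have jac: "pair a (op_deriv J u (J u b) c) + pair b (op_deriv J u (J u c) a) +
      pair c (op_deriv J u (J u a) b) = 0" for a b c u
  proof -
    have "\<forall>\<alpha>\<in>cotangent_fields. \<forall>\<beta>\<in>cotangent_fields. \<forall>\<gamma>\<in>cotangent_fields. \<forall>u.
        pair (\<alpha> u) (op_deriv J u (J u (\<beta> u)) (\<gamma> u)) +
        pair (\<beta> u) (op_deriv J u (J u (\<gamma> u)) (\<alpha> u)) +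
        pair (\<gamma> u) (op_deriv J u (J u (\<alpha> u)) (\<beta> u)) = 0"
      using assms(4) unfolding hamiltonian_def by blast
    from bspec[OF bspec[OF bspec[OF this const[of a]] const[of b]] const[of c]] show ?thesis by blast
  qed
  note ctx = assms(1) op assms(3)
  have "hat_pair pair \<alpha> (J_hat N idx J \<eta> \<beta>) = - hat_pair pair \<beta> (J_hat N idx J \<eta> \<alpha>)" for \<alpha> \<beta> \<eta>
  proof -
    let ?t = "\<lambda>a b m. if m < N then 0 else taylor_coeff (m - N) (\<lambda>\<epsilon>. pair a (J (u_hat idx \<eta> \<epsilon>) b))"
    have "smooth (\<lambda>\<epsilon>. pair a (J (u_hat idx \<eta> \<epsilon>) b))" for a b
      by (intro smooth_linear_compose[OF pair_linear[OF ctx] pair_continuous[OF ctx]] smooth_J_curve[OF ctx])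
    \<comment> \<open>Skew symmetry along the curve is multiplication by -1, which passes to every
      coefficient.\<close>
    from taylor_coeff_scaleR[OF this, of _ "-1"]
    have t: "?t a b m = - ?t b a m" for a b m
      by (simp add: skew[of a _ b])
    have "hat_pair pair \<alpha> (J_hat N idx J \<eta> \<beta>) = (\<Sum>i\<in>UNIV. \<Sum>j\<in>UNIV. - ?t (\<beta> $ j) (\<alpha> $ i) (idx j + idx i))"
      unfolding hat_pair_J_hat[OF ctx] by (subst t) (simp add: add.commute cong: if_cong)
    also have "\<dots> = - hat_pair pair \<beta> (J_hat N idx J \<eta> \<alpha>)"
      unfolding hat_pair_J_hat[OF ctx] by (subst sum.swap) (simp add: sum_negf)
    finally show ?thesis .
  qed
  moreover have "hat_pair pair \<alpha> (op_deriv (J_hat N idx J) \<eta> (J_hat N idx J \<eta> \<beta>) \<gamma>) +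
      hat_pair pair \<beta> (op_deriv (J_hat N idx J) \<eta> (J_hat N idx J \<eta> \<gamma>) \<alpha>) +
      hat_pair pair \<gamma> (op_deriv (J_hat N idx J) \<eta> (J_hat N idx J \<eta> \<alpha>) \<beta>) = 0" for \<alpha> \<beta> \<gamma> \<eta>
  proof -
    let ?T = "jacobi_term pair J N idx \<eta>"
    \<comment> \<open>The order of the coefficient depends only on the sum of the indices. Renaming
      the summation indices attaches \<open>i\<close> to \<alpha>, \<open>j\<close> to \<beta> and
      \<open>l\<close> to \<gamma> in all three cyclic sums, which then cancel term by term.\<close>
    have "(\<Sum>i\<in>UNIV. \<Sum>l\<in>UNIV. \<Sum>j\<in>UNIV. ?T (\<beta> $ i) (\<gamma> $ j) (\<alpha> $ l) (idx i + idx l + idx j)) =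
        (\<Sum>i\<in>UNIV. \<Sum>l\<in>UNIV. \<Sum>j\<in>UNIV. ?T (\<beta> $ j) (\<gamma> $ l) (\<alpha> $ i) (idx i + idx l + idx j))"
      by (subst sum.swap, rule sum.cong[OF refl], subst sum.swap) (simp add: ac_simps)
    moreover have "(\<Sum>i\<in>UNIV. \<Sum>l\<in>UNIV. \<Sum>j\<in>UNIV. ?T (\<gamma> $ i) (\<alpha> $ j) (\<beta> $ l) (idx i + idx l + idx j)) =
        (\<Sum>i\<in>UNIV. \<Sum>l\<in>UNIV. \<Sum>j\<in>UNIV. ?T (\<gamma> $ l) (\<alpha> $ i) (\<beta> $ j) (idx i + idx l + idx j))"
    proof -
      have "(\<Sum>i\<in>UNIV. \<Sum>l\<in>UNIV. \<Sum>j\<in>UNIV. ?T (\<gamma> $ i) (\<alpha> $ j) (\<beta> $ l) (idx i + idx l + idx j)) =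
          (\<Sum>i\<in>UNIV. \<Sum>j\<in>UNIV. \<Sum>l\<in>UNIV. ?T (\<gamma> $ i) (\<alpha> $ j) (\<beta> $ l) (idx i + idx l + idx j))"
        by (intro sum.cong refl sum.swap)
      also have "\<dots> = (\<Sum>j\<in>UNIV. \<Sum>i\<in>UNIV. \<Sum>l\<in>UNIV. ?T (\<gamma> $ i) (\<alpha> $ j) (\<beta> $ l) (idx i + idx l + idx j))"
        by (rule sum.swap)
      finally show ?thesis by (simp add: ac_simps)
    qed
    ultimately show ?thesis
      unfolding hat_pair_op_deriv_J_hat[OF ctx]
      by (simp add: sum.distrib[symmetric] jacobi_term_cycle[OF ctx jac])
  qed
  ultimately show ?thesis
    unfolding hamiltonian_def using linear_operator_J_hat[OF op] by blast
qed

end
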